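(* Let $M$ be a countable structure and $d$ a non-zero, integer-valued dimension function on $M$ such that $\mathrm{cl}^d$ subsumes definable closure and $\downarrow^d$ satisfies Existence. Suppose $\downarrow^d$ is stationary and $A\in\mathcal{X}$ is such that there is a basic $\mathrm{Aut}(M/A)$-orbit $D$ with $\mathrm{cl}^d(A,D)=M$. Suppose $g\in\mathrm{Aut}(M/\mathrm{cl}^d(\emptyset))$ is not $\mathrm{cl}^d$-bounded. Then every element of $\mathrm{Aut}(M/\mathrm{cl}^d(\emptyset))$ is a product of 96 conjugates of $g^{\pm1}$.
   Context: $M$ is a countable first-order structure, $G=\mathrm{Aut}(M)$; for $X\subseteq M$, $G_X=\mathrm{Aut}(M/X)$ is the pointwise stabilizer of $X$ in $G$, and $\mathrm{orb}(a/X)$ is the $G_X$-orbit of $a$. Juxtaposition or commas denote unions, e.g. $\mathrm{cl}^d(A,D)=\mathrm{cl}^d(A\cup D)$. An integer-valued function $d$ on finite subsets (or tuples) of $M$ is a dimension function if for all finite $X,Y\subseteq M$: $d(gX)=d(X)$ for all $g\in G$, and $0\le d(X)\le d(X\cup Y)\le d(X)+d(Y)-d(X\cap Y)$. We assume $d(\emptyset)=0$. Put $d(X/Y)=d(X\cup Y)-d(Y)$ for finite $X,Y$; for arbitrary $Z\subseteq M$, $d(X/Z)=\min\{d(X/Y):Y\subseteq Z\text{ finite}\}$; and $\mathrm{cl}^d(Z)=\{a\in M:d(a/Z)=0\}$. Dimensions of arbitrary sets (possibly over a set) are maxima of the dimensions of their finite subsets. Let $\mathcal{X}=\{\mathrm{cl}^d(X):X\subseteq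 M\text{ finite}\}$, and for $A,B,C\in\mathcal{X}$ (or finite sets or tuples) write $A\downarrow^d_B C$ iff $d(A/B\cup C)=d(A/B)$. $\mathrm{cl}^d$ subsumes definable closure: whenever $X\subseteq M$ is finite and $a\in M$ is fixed by $G_{\mathrm{cl}^d(X)}$, then $a\in\mathrm{cl}^d(X)$. Existence: for all $A,B,C\in\mathcal{X}$ there is $g\in G_B$ with $gA\downarrow^d_B C$. $\downarrow^d$ is stationary: if $A_1,A_2,B,C\in\mathcal{X}$, $B\subseteq A_i$ and $A_i\downarrow^d_B C$ for $i=1,2$, and $h:A_1\to A_2$ is a bijection which is the identity on $B$ and extends to an element of $G$, then there is an element of $G$ extending $h\cup\mathrm{id}_C$. For $A\in\mathcal{X}$, $b\in M$ is basic over $A$ if $b\notin A$ and whenever $A\subseteq C\in\mathcal{X}$ and $d(b/C)<d(b/A)$, then $b\in C$; then $\mathrm{orb}(b/A)$ is a basic $G_A$-orbit (basic orbit over $A$). $g\in\mathrm{Aut}(M)$ is $\mathrm{cl}^d$-bounded if there is $E\in\mathcal{X}$ such that $g$ stabilizes setwise every $B\in\mathcal{X}$ which contains $E$. "Conjugates of $g^{\pm1}$" means conjugates, in the group $\mathrm{Aut}(M/\mathrm{cl}^d(\emptyset))$, of $g$ or $g^{-1}$. *)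

theory Defs
  imports Main "HOL-Library.Countable_Set"
begin

(* The universe is the whole type 'a.  A symbol is a name together with its arity; the
   interpretations only matter on symbols of the language and on lists of the right length. *)
record ('f, 'r, 'a) fo_structure =
  fun_symbols :: "('f \<times> nat) set"
  rel_symbols :: "('r \<times> nat) set"
  fun_interp :: "'f \<times> nat \<Rightarrow> 'a list \<Rightarrow> 'a"
  rel_interp :: "'r \<times> nat \<Rightarrow> 'a list \<Rightarrow> bool"

definition Aut :: "('f, 'r, 'a) fo_structure \<Rightarrow> ('a \<Rightarrow> 'a) set" where
  "Aut M = {g. bij g
     \<and> (\<forall>f n xs. (f, n) \<in> fun_symbols M \<and> length xs = n \<longrightarrow>
           g (fun_interp M (f, n) xs) = fun_interp M (f, n) (map g xs))
     \<and> (\<forall>r n xs. (r, n) \<in> rel_symbols M \<and> length xs = n \<longrightarrow>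
           (rel_interp M (r, n) (map g xs) \<longleftrightarrow> rel_interp M (r, n) xs))}"

definition Aut_over :: "('f, 'r, 'a) fo_structure \<Rightarrow> 'a set \<Rightarrow> ('a \<Rightarrow> 'a) set" where
  "Aut_over M X = {g \<in> Aut M. \<forall>x\<in>X. g x = x}"

definition orb :: "('f, 'r, 'a) fo_structure \<Rightarrow> 'a \<Rightarrow> 'a set \<Rightarrow> 'a set" where
  "orb M a X = {g a | g. g \<in> Aut_over M X}"

(* Only the values of d on finite sets are ever constrained or used. *)
definition dimension_function ::
  "('f, 'r, 'a) fo_structure \<Rightarrow> ('a set \<Rightarrow> int) \<Rightarrow> bool" where
  "dimension_function M d \<longleftrightarrow>
     d {} = 0 \<and>
     (\<forall>X g. finite X \<and> g \<in> Aut M \<longrightarrow> d (g ` X) = d X) \<and>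
     (\<forall>X Y. finite X \<and> finite Y \<longrightarrow>
        0 \<le> d X \<and> d X \<le> d (X \<union> Y) \<and> d (X \<union> Y) \<le> d X + d Y - d (X \<inter> Y))"

definition nonzero_dimension :: "('a set \<Rightarrow> int) \<Rightarrow> bool" where
  "nonzero_dimension d \<longleftrightarrow> (\<exists>X. finite X \<and> d X \<noteq> 0)"

(* d(X/Z) for finite X and arbitrary Z.  The set is finite because its members lie
   between 0 and d X. *)
definition fin_dim_over :: "('a set \<Rightarrow> int) \<Rightarrow> 'a set \<Rightarrow> 'a set \<Rightarrow> int" where
  "fin_dim_over d X Z = Min {d (X \<union> Y) - d Y | Y. finite Y \<and> Y \<subseteq> Z}"

(* d(A/Z) for arbitrary A.  The maximum is over a finite set whenever A has finite
   dimension, in particular for finite A and for closures of finite sets; Max is not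
   meaningful for other A. *)
definition dim_over :: "('a set \<Rightarrow> int) \<Rightarrow> 'a set \<Rightarrow> 'a set \<Rightarrow> int" where
  "dim_over d A Z = Max {fin_dim_over d X Z | X. finite X \<and> X \<subseteq> A}"

definition cl :: "('a set \<Rightarrow> int) \<Rightarrow> 'a set \<Rightarrow> 'a set" where
  "cl d Z = {a. fin_dim_over d {a} Z = 0}"

definition fin_closures :: "('a set \<Rightarrow> int) \<Rightarrow> 'a set set" where
  "fin_closures d = {cl d X | X. finite X}"

definition indep :: "('a set \<Rightarrow> int) \<Rightarrow> 'a set \<Rightarrow> 'a set \<Rightarrow> 'a set \<Rightarrow> bool" where
  "indep d A B C \<longleftrightarrow> dim_over d A (B \<union> C) = dim_over d A B"

definition subsumes_dcl :: "('f, 'r, 'a) fo_structure \<Rightarrow> ('a set \<Rightarrow> int) \<Rightarrow> bool" where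
  "subsumes_dcl M d \<longleftrightarrow>
     (\<forall>X a. finite X \<and> (\<forall>g \<in> Aut_over M (cl d X). g a = a) \<longrightarrow> a \<in> cl d X)"

definition indep_existence :: "('f, 'r, 'a) fo_structure \<Rightarrow> ('a set \<Rightarrow> int) \<Rightarrow> bool" where
  "indep_existence M d \<longleftrightarrow>
     (\<forall>A \<in> fin_closures d. \<forall>B \<in> fin_closures d. \<forall>C \<in> fin_closures d.
        \<exists>g \<in> Aut_over M B. indep d (g ` A) B C)"

definition indep_stationary :: "('f, 'r, 'a) fo_structure \<Rightarrow> ('a set \<Rightarrow> int) \<Rightarrow> bool" where
  "indep_stationary M d \<longleftrightarrow>
     (\<forall>A1 \<in> fin_closures d. \<forall>A2 \<in> fin_closures d.
      \<forall>B \<in> fin_closures d. \<forall>C \<in> fin_closures d. \<forall>h.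
        B \<subseteq> A1 \<and> B \<subseteq> A2 \<and> indep d A1 B C \<and> indep d A2 B C \<and>
        bij_betw h A1 A2 \<and> (\<forall>x\<in>B. h x = x) \<and> (\<exists>g \<in> Aut M. \<forall>x\<in>A1. g x = h x) \<longrightarrow>
        (\<exists>k \<in> Aut M. (\<forall>x\<in>A1. k x = h x) \<and> (\<forall>x\<in>C. k x = x)))"

definition basic_over :: "('a set \<Rightarrow> int) \<Rightarrow> 'a \<Rightarrow> 'a set \<Rightarrow> bool" where
  "basic_over d b A \<longleftrightarrow> b \<notin> A \<and>
     (\<forall>C \<in> fin_closures d. A \<subseteq> C \<and> fin_dim_over d {b} C < fin_dim_over d {b} A \<longrightarrow> b \<in> C)"

definition basic_orbit ::
  "('f, 'r, 'a) fo_structure \<Rightarrow> ('a set \<Rightarrow> int) \<Rightarrow> 'a set \<Rightarrow> 'a set \<Rightarrow> bool" where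
  "basic_orbit M d A D \<longleftrightarrow> (\<exists>b. basic_over d b A \<and> D = orb M b A)"

definition cl_bounded :: "('a set \<Rightarrow> int) \<Rightarrow> ('a \<Rightarrow> 'a) \<Rightarrow> bool" where
  "cl_bounded d g \<longleftrightarrow>
     (\<exists>E \<in> fin_closures d. \<forall>B \<in> fin_closures d. E \<subseteq> B \<longrightarrow> g ` B = B)"

definition conjugates_pm :: "('a \<Rightarrow> 'a) set \<Rightarrow> ('a \<Rightarrow> 'a) \<Rightarrow> ('a \<Rightarrow> 'a) set" where
  "conjugates_pm H g = {u \<circ> k \<circ> inv u | u k. u \<in> H \<and> k \<in> {g, inv g}}"

(* Sanity checks: the minima and maxima above are taken over finite nonempty sets, and
   the relative dimension agrees with the usual one on finite sets. *)

lemma dimension_functionD: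
  assumes "dimension_function M d"
  shows "d {} = 0"
    and "finite X \<Longrightarrow> 0 \<le> d X"
    and "finite X \<Longrightarrow> finite Y \<Longrightarrow> d X \<le> d (X \<union> Y)"
    and "finite X \<Longrightarrow> finite Y \<Longrightarrow> d (X \<union> Y) \<le> d X + d Y - d (X \<inter> Y)"
  using assms unfolding dimension_function_def by simp_all

lemma fin_dim_over_set_finite:
  assumes "dimension_function M d" "finite X"
  shows "finite {d (X \<union> Y) - d Y | Y. finite Y \<and> Y \<subseteq> Z}"
proof (rule finite_subset)
  have "0 \<le> d (X \<union> Y) - d Y \<and> d (X \<union> Y) - d Y \<le> d X" if "finite Y" for Y
  proof -
    have "d Y \<le> d (Y \<union> X)" "d (X \<union> Y) \<le> d X + d Y - d (X \<inter> Y)" "0 \<le> d (X \<inter> Y)"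
      using dimension_functionD[OF assms(1)] assms(2) that by auto
    then show ?thesis by (simp add: Un_commute)
  qed
  then show "{d (X \<union> Y) - d Y | Y. finite Y \<and> Y \<subseteq> Z} \<subseteq> {0..d X}"
    by auto
qed simp

lemma fin_dim_over_finite:
  assumes D: "dimension_function M d" and X: "finite X" and Z: "finite Z"
  shows "fin_dim_over d X Z = d (X \<union> Z) - d Z"
  unfolding fin_dim_over_def
proof (rule Min_eqI)
  fix n assume "n \<in> {d (X \<union> Y) - d Y | Y. finite Y \<and> Y \<subseteq> Z}"
  then obtain Y where Y: "n = d (X \<union> Y) - d Y" "finite Y" "Y \<subseteq> Z" by blast
  have fin: "finite (X \<union> Y)" "finite ((X \<union> Y) \<inter> Z)" using X Y by auto
  have "d ((X \<union> Y) \<union> Z) \<le> d (X \<union> Y) + d Z - d ((X \<union> Y) \<inter> Z)"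
    using fin(1) Z by (rule dimension_functionD[OF D])
  moreover have "d Y \<le> d (Y \<union> ((X \<union> Y) \<inter> Z))"
    using Y(2) fin(2) by (rule dimension_functionD[OF D])
  moreover have "(X \<union> Y) \<union> Z = X \<union> Z" "Y \<union> ((X \<union> Y) \<inter> Z) = (X \<union> Y) \<inter> Z"
    using Y(3) by auto
  ultimately show "d (X \<union> Z) - d Z \<le> n" using Y(1) by simp
qed (use fin_dim_over_set_finite[OF D X] Z in auto)

lemma dim_over_set_finite:
  assumes D: "dimension_function M d" and X: "finite X"
  shows "finite {fin_dim_over d F Z | F. finite F \<and> F \<subseteq> cl d X}"
proof (rule finite_subset)
  have gen: "d (F \<union> X) \<le> d X" if "finite F" "F \<subseteq> cl d X" for F
    using that
  proof (induction F rule: finite_induct)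
    case (insert a F)
    have "d (insert a X) - d X = 0"
      using insert.prems fin_dim_over_finite[OF D _ X, of "{a}"] by (simp add: cl_def)
    moreover have "d ((F \<union> X) \<union> insert a X)
        \<le> d (F \<union> X) + d (insert a X) - d ((F \<union> X) \<inter> insert a X)"
      using X insert.hyps by (intro dimension_functionD[OF D]) auto
    moreover have "d X \<le> d (X \<union> ((F \<union> X) \<inter> insert a X))"
      using X insert.hyps by (intro dimension_functionD[OF D]) auto
    moreover have "X \<union> ((F \<union> X) \<inter> insert a X) = (F \<union> X) \<inter> insert a X"
      "(F \<union> X) \<union> insert a X = insert a F \<union> X" by auto
    ultimately show ?case using insert.IH insert.prems by simp
  qed simp
  have "0 \<le> fin_dim_over d F Z \<and> fin_dim_over d F Z \<le> d X"
    if F: "finite F" "F \<subseteq> cl d X" for F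
  proof -
    let ?S = "{d (F \<union> Y) - d Y | Y. finite Y \<and> Y \<subseteq> Z}"
    have S: "finite ?S" "d (F \<union> {}) - d {} \<in> ?S"
      using fin_dim_over_set_finite[OF D F(1)] by blast+
    have "Min ?S \<in> ?S" using S by (intro Min_in) auto
    then obtain Y where Y: "Min ?S = d (F \<union> Y) - d Y" "finite Y" by auto
    have "d Y \<le> d (Y \<union> F)" "d F \<le> d (F \<union> X)" "d {} = 0"
      using Y(2) F(1) X by (auto intro: dimension_functionD[OF D])
    moreover have "Min ?S \<le> d (F \<union> {}) - d {}" using S by (intro Min_le)
    ultimately show ?thesis
      using Y(1) gen[OF F] by (simp add: fin_dim_over_def Un_commute)
  qed
  then show "{fin_dim_over d F Z | F. finite F \<and> F \<subseteq> cl d X} \<subseteq> {0..d X}"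
    by auto
qed simp

end

theory Submission
  imports Defs
begin

text \<open>
  Eight conjugates of \<open>g\<close> already multiply to any given automorphism; pairs \<open>g\<close>,
  \<open>inv g\<close> then fill the list up to length 96. Two ideas carry the proof.

  The first is due to Tent and Ziegler and needs only a stationary independence relation. Say
  that \<open>g\<close> moves almost maximally if over every flat set \<open>B\<close> each small set has a copy that
  is independent over \<open>B\<close> from its image under \<open>g\<close>. By stationarity such a copy
  together with its image realises the unique free type of a pair, and this makes conjugates of
  \<open>g\<close> very flexible: a conjugate can be found that agrees with a prescribed partial
  automorphism \<open>s\<close>, as long as the domain and the range of \<open>s\<close> are in general position
  (\<open>conjugate_matching\<close>). The ends of a product of four conjugates can be brought into
  general position by the two outer factors, while the set in the middle is chosen freely. Hence
  a product of four conjugates, each allowed to vary in a given open set, is dense in some open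
  set of automorphisms (\<open>somewhere_dense\<close>). Two such open sets, one of them conjugated by a
  generic automorphism, have a product that contains a given \<open>f\<close>, and a back-and-forth
  construction on the eight conjugating automorphisms reaches \<open>f\<close> exactly
  (\<open>eight_conjugates\<close>).

  The second idea is that in the presence of the basic orbit \<open>D\<close> an automorphism that is not
  bounded moves almost maximally. An element \<open>b\<close> of \<open>D\<close> lies in a given flat set above
  \<open>A\<close> or is independent from it over \<open>A\<close>, so over a flat set above \<open>A\<close> independence of
  \<open>b\<close> from its image just says that \<open>b\<close> is not in the closure of that set and \<open>g b\<close>.
  If this failed for all \<open>b\<close> outside some flat set, then \<open>g\<close> would preserve every large flat
  set spanned over it by elements of \<open>D\<close>; every large flat set is an intersection of two of those, and
  \<open>g\<close> would be bounded (\<open>unbounded_moves_basic\<close>). Moving one basic element at a time extends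
  this to finite subsets of \<open>D\<close> (\<open>move_basic_set\<close>), and these span everything over \<open>A\<close>.
\<close>

section \<open>Stationary independence\<close>

text \<open>
  Independence is axiomatised for all small sets, closed or not, because this avoids taking
  hulls of unions throughout. Only the base in existence and stationarity has to be closed: an
  automorphism that fixes a set pointwise may move points of its hull. The assumption
  \<open>G_closed\<close> says that \<open>G\<close> is closed for pointwise convergence and is what lets a
  back-and-forth construction end in \<open>G\<close>.
\<close>

locale stationary_independence =
  fixes G :: "('a \<Rightarrow> 'a) set"
    and hull :: "'a set \<Rightarrow> 'a set"
    and small :: "'a set \<Rightarrow> bool"
    and ind :: "'a set \<Rightarrow> 'a set \<Rightarrow> 'a set \<Rightarrow> bool"
  assumes G_bij: "u \<in> G \<Longrightarrow> bij u"
    and G_id: "id \<in> G"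
    and G_comp: "u \<in> G \<Longrightarrow> v \<in> G \<Longrightarrow> u \<circ> v \<in> G"
    and G_inv: "u \<in> G \<Longrightarrow> inv u \<in> G"
    and G_fixes: "u \<in> G \<Longrightarrow> x \<in> hull {} \<Longrightarrow> u x = x"
    and G_closed: "bij f \<Longrightarrow> (\<And>F. finite F \<Longrightarrow> \<exists>u\<in>G. \<forall>x\<in>F. u x = f x) \<Longrightarrow> f \<in> G"
    and small_finite: "finite S \<Longrightarrow> small S"
    and small_Un: "small S \<Longrightarrow> small T \<Longrightarrow> small (S \<union> T)"
    and small_image: "u \<in> G \<Longrightarrow> small S \<Longrightarrow> small (u ` S)"
    and small_hull: "small S \<Longrightarrow> small (hull S)"
    and hull_extensive: "S \<subseteq> hull S"
    and hull_mono: "S \<subseteq> T \<Longrightarrow> hull S \<subseteq> hull T"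
    and hull_idem: "hull (hull S) = hull S"
    and hull_image: "u \<in> G \<Longrightarrow> hull (u ` S) = u ` hull S"
    and ind_small: "ind A B C \<Longrightarrow> small A \<and> small B \<and> small C"
    and ind_sym: "ind A B C \<Longrightarrow> ind C B A"
    and ind_mono: "ind A B C \<Longrightarrow> A' \<subseteq> hull (A \<union> B) \<Longrightarrow> C' \<subseteq> hull (B \<union> C) \<Longrightarrow> ind A' B C'"
    and ind_base: "ind A B C \<Longrightarrow> B \<subseteq> B' \<Longrightarrow> B' \<subseteq> hull (B \<union> C) \<Longrightarrow> ind A B' C"
    and ind_trans: "ind A B B' \<Longrightarrow> B \<subseteq> B' \<Longrightarrow> ind A B' C \<Longrightarrow> ind A B C"
    and ind_image: "u \<in> G \<Longrightarrow> ind A B C \<Longrightarrow> ind (u ` A) (u ` B) (u ` C)"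
    and existence: "small A \<Longrightarrow> small B \<Longrightarrow> hull B = B \<Longrightarrow> small C
      \<Longrightarrow> \<exists>u\<in>G. (\<forall>x\<in>B. u x = x) \<and> ind (u ` A) B C"
    and stationarity: "small B \<Longrightarrow> hull B = B \<Longrightarrow> u \<in> G \<Longrightarrow> (\<forall>x\<in>B. u x = x)
      \<Longrightarrow> ind A B C \<Longrightarrow> ind (u ` A) B C
      \<Longrightarrow> \<exists>w\<in>G. (\<forall>x\<in>A. w x = u x) \<and> (\<forall>x\<in>B \<union> C. w x = x)"
begin

text \<open>
  Closed small sets are called flats, as in matroid theory. In the application they are the
  closures of finite sets.
\<close>

definition flat :: "'a set \<Rightarrow> bool" where
  "flat B \<longleftrightarrow> small B \<and> hull B = B"

definition stab :: "'a set \<Rightarrow> ('a \<Rightarrow> 'a) set" where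
  "stab B = {u \<in> G. \<forall>x\<in>B. u x = x}"

definition conj_by :: "('a \<Rightarrow> 'a) \<Rightarrow> ('a \<Rightarrow> 'a) \<Rightarrow> 'a \<Rightarrow> 'a" where
  "conj_by k g = k \<circ> g \<circ> inv k"

definition moves_almost_maximally :: "('a \<Rightarrow> 'a) \<Rightarrow> bool" where
  "moves_almost_maximally g \<longleftrightarrow>
     (\<forall>A B. small A \<and> flat B \<longrightarrow> (\<exists>u\<in>stab B. ind (u ` A) B (g ` u ` A)))"

lemma inv_left [simp]: "u \<in> G \<Longrightarrow> inv u (u x) = x"
  by (simp add: G_bij bij_is_inj)

lemma inv_right [simp]: "u \<in> G \<Longrightarrow> u (inv u x) = x"
  by (meson G_bij bij_inv_eq_iff)

lemma inv_image_left [simp]: "u \<in> G \<Longrightarrow> inv u ` u ` S = S"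
  by (simp add: image_image)

lemma inv_image_right [simp]: "u \<in> G \<Longrightarrow> u ` inv u ` S = S"
  by (simp add: image_image)

lemma inv_inv_G [simp]: "u \<in> G \<Longrightarrow> inv (inv u) = u"
  by (simp add: G_bij inv_inv_eq)

lemma inv_comp_G: "u \<in> G \<Longrightarrow> v \<in> G \<Longrightarrow> inv (u \<circ> v) = inv v \<circ> inv u"
  by (simp add: G_bij o_inv_distrib)

lemma conj_by_in_G: "k \<in> G \<Longrightarrow> g \<in> G \<Longrightarrow> conj_by k g \<in> G"
  by (simp add: conj_by_def G_comp G_inv)

lemma conj_by_comp:
  "k \<in> G \<Longrightarrow> l \<in> G \<Longrightarrow> conj_by k (conj_by l g) = conj_by (k \<circ> l) g"
  by (simp add: conj_by_def inv_comp_G comp_assoc)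

lemma inv_conj_by: "k \<in> G \<Longrightarrow> g \<in> G \<Longrightarrow> inv (conj_by k g) = conj_by k (inv g)"
  by (simp add: conj_by_def inv_comp_G G_comp G_inv comp_assoc)

lemma stab_in_G: "u \<in> stab B \<Longrightarrow> u \<in> G"
  by (simp add: stab_def)

lemma stab_fixes: "u \<in> stab B \<Longrightarrow> x \<in> B \<Longrightarrow> u x = x"
  by (simp add: stab_def)

lemma stab_comp: "u \<in> stab B \<Longrightarrow> v \<in> stab B \<Longrightarrow> u \<circ> v \<in> stab B"
  by (simp add: stab_def G_comp)

lemma stab_inv: "u \<in> stab B \<Longrightarrow> inv u \<in> stab B"
proof -
  assume u: "u \<in> stab B"
  have "inv u x = x" if "x \<in> B" for x
    using u that inv_left[of u x] by (simp add: stab_def)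
  then show ?thesis using u by (simp add: stab_def G_inv)
qed

lemma stab_antimono: "B \<subseteq> C \<Longrightarrow> stab C \<subseteq> stab B"
  by (auto simp: stab_def)

lemma stab_image: "u \<in> stab B \<Longrightarrow> S \<subseteq> B \<Longrightarrow> u ` S = S"
  by (force simp: stab_def)

lemma flat_hull: "small S \<Longrightarrow> flat (hull S)"
  by (simp add: flat_def small_hull hull_idem)

lemma flat_image: "flat B \<Longrightarrow> u \<in> G \<Longrightarrow> flat (u ` B)"
  by (simp add: flat_def small_image hull_image)

lemma flat_small: "flat B \<Longrightarrow> small B"
  by (simp add: flat_def)

lemma subset_hull: "S \<subseteq> T \<Longrightarrow> S \<subseteq> hull T"
  using hull_extensive by blast

lemma ind_subset: "ind A B C \<Longrightarrow> A' \<subseteq> A \<union> B \<Longrightarrow> C' \<subseteq> B \<union> C \<Longrightarrow> ind A' B C'"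
  by (meson ind_mono hull_extensive subset_trans)

lemma existence_stab:
  assumes "small A" "flat B" "small C"
  obtains u where "u \<in> stab B" "ind (u ` A) B C"
  using existence assms unfolding flat_def stab_def by blast

text \<open>
  Two partial automorphisms on sets that are independent on the side of the domain and on the side
  of the range have a common extension. Composing with the inverse of the second map reduces this to
  the case in which the second map is the identity, which is stationarity.
\<close>

lemma amalgamate_maps:
  assumes B: "flat B" and p: "p \<in> stab B" and q: "q \<in> stab B"
    and AC: "ind A B C" and pq: "ind (p ` A) B (q ` C)"
  obtains w where "w \<in> stab B" "\<forall>x\<in>A. w x = p x" "\<forall>x\<in>C. w x = q x"
proof -
  note G = stab_in_G[OF p] stab_in_G[OF q]
  have r: "inv q \<circ> p \<in> stab B" using p q stab_comp stab_inv by blast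
  have "ind (inv q ` p ` A) (inv q ` B) (inv q ` q ` C)"
    using pq G by (intro ind_image) (auto intro: G_inv)
  then have "ind ((inv q \<circ> p) ` A) B C"
    using G stab_image[OF stab_inv[OF q] order_refl] by (simp add: image_comp)
  then obtain w where w: "w \<in> G" "\<forall>x\<in>A. w x = (inv q \<circ> p) x" "\<forall>x\<in>B \<union> C. w x = x"
    using stationarity[of B "inv q \<circ> p" A C] B AC r unfolding flat_def stab_def by blast
  have "q \<circ> w \<in> stab B" using q w(1,3) by (auto simp: stab_def G_comp)
  then show ?thesis using that[of "q \<circ> w"] w G by auto
qed

section \<open>Conjugates with prescribed values\<close>

lemma conjugate_moves_almost_maximally:
  assumes g: "g \<in> G" "moves_almost_maximally g" and k: "k \<in> G"
  shows "moves_almost_maximally (conj_by k g)"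
  unfolding moves_almost_maximally_def
proof (intro allI impI, elim conjE)
  fix A B assume A: "small A" and B: "flat B"
  have "small (inv k ` A)" "flat (inv k ` B)"
    using A B k by (auto intro: small_image flat_image G_inv)
  then obtain u where u: "u \<in> stab (inv k ` B)"
    and i: "ind (u ` inv k ` A) (inv k ` B) (g ` u ` inv k ` A)"
    using g(2) unfolding moves_almost_maximally_def by blast
  have "conj_by k u \<in> stab B"
    using u k by (auto simp: stab_def conj_by_in_G) (simp add: conj_by_def)
  moreover have "ind (k ` u ` inv k ` A) B (k ` g ` u ` inv k ` A)"
    using ind_image[OF k i] k by simp
  then have "ind (conj_by k u ` A) B (conj_by k g ` conj_by k u ` A)"
    using k by (simp add: conj_by_def image_comp comp_def)
  ultimately show "\<exists>u\<in>stab B. ind (u ` A) B (conj_by k g ` u ` A)" by blast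
qed

text \<open>
  Let \<open>A'\<close> be a copy of \<open>A\<close> over \<open>X\<close> that is independent over \<open>X\<close> from its own image
  \<open>g ` A'\<close> and from the translates of \<open>X\<close>. Then the pairs of \<open>A\<close> and \<open>s ` A\<close>, and of \<open>A'\<close> and
  \<open>g ` A'\<close>, are both free over \<open>X\<close> and \<open>g ` X\<close>, so some automorphism \<open>w\<close> takes the first pair
  to the second. Conjugating \<open>g\<close> by \<open>inv w\<close> gives a map with the values of \<open>s\<close>.
\<close>

lemma conjugate_matching:
  assumes g: "g \<in> G" "moves_almost_maximally g" and X: "flat X"
    and s: "s \<in> G" "\<forall>x\<in>X. s x = g x" and XA: "X \<subseteq> A"
    and i1: "ind A X (g ` X \<union> s ` A)" and i2: "ind (s ` A) (g ` X) X"
  obtains k where "k \<in> stab (X \<union> g ` X)" "\<forall>a\<in>A. conj_by k g a = s a"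
proof -
  have sm: "small A" "small X" using ind_small i1 by auto
  \<comment> \<open>Independence from the preimage of X turns, after applying g, into independence of the
      image of the copy from X.\<close>
  define Z where "Z = hull (X \<union> g ` X \<union> inv g ` X)"
  have Z: "flat Z" unfolding Z_def using sm g(1)
    by (intro flat_hull small_Un small_image G_inv) auto
  have XZ: "X \<union> g ` X \<union> inv g ` X \<subseteq> Z"
    unfolding Z_def by (rule hull_extensive)
  obtain v where v: "v \<in> stab X" "ind (v ` A) X Z"
    using existence_stab[OF sm(1) X flat_small[OF Z]] by blast
  have "small (v ` A)" using v(2) ind_small by blast
  then obtain u where u: "u \<in> stab Z" "ind (u ` v ` A) Z (g ` u ` v ` A)"
    using g(2) Z unfolding moves_almost_maximally_def by blast
  define t where "t = u \<circ> v"
  have uX: "u \<in> stab X" using u(1) XZ stab_antimono[of X Z] by auto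
  have t: "t \<in> stab X" unfolding t_def using stab_comp uX v(1) by blast
  note tG = stab_in_G[OF t]
  have tA: "u ` v ` A = t ` A" by (simp add: t_def image_comp)
  have "ind (u ` v ` A) (u ` X) (u ` Z)"
    using ind_image[OF stab_in_G[OF u(1)] v(2)] .
  then have a1: "ind (t ` A) X Z"
    using stab_image[OF uX order_refl] stab_image[OF u(1) order_refl] tA by simp
  have a2: "ind (t ` A) X (g ` t ` A)"
    using ind_trans[OF a1 _ u(2)[unfolded tA]] XZ by auto
  have "ind (g ` t ` A) (g ` X) (g ` Z)" using ind_image[OF g(1) a1] .
  moreover have "X \<subseteq> g ` Z"
    using image_mono[of "inv g ` X" Z g] XZ g(1) by simp
  ultimately have a3: "ind (g ` t ` A) (g ` X) X" by (auto intro: ind_subset)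
  have gX: "flat (g ` X)" using flat_image X g(1) by blast
  \<comment> \<open>The map that w has to induce on the range of s; it is the identity on the image of X.\<close>
  define q0 where "q0 = g \<circ> t \<circ> inv s"
  have q0: "q0 \<in> G" using q0_def g s tG by (simp add: G_comp G_inv)
  have q0X: "\<forall>y\<in>g ` X. q0 y = y"
  proof
    fix y assume "y \<in> g ` X"
    then obtain x where x: "x \<in> X" "y = g x" by blast
    then have "inv s y = x" using s by (metis inv_left)
    then show "q0 y = y" using x stab_fixes[OF t] by (simp add: q0_def)
  qed
  have "q0 ` s ` A = g ` t ` A" using s(1) by (simp add: q0_def image_comp comp_def)
  then obtain q where q: "q \<in> G" "\<forall>x\<in>s ` A. q x = q0 x" "\<forall>x\<in>g ` X \<union> X. q x = x"
    using stationarity[of "g ` X" q0 "s ` A" X] gX q0 q0X i2 a3 unfolding flat_def by auto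
  have qX: "q \<in> stab X" using q by (auto simp: stab_def)
  have qs: "q (s a) = g (t a)" if "a \<in> A" for a
    using q(2) that s(1) by (simp add: q0_def)
  then have "q ` s ` A = g ` t ` A" by (simp add: image_image)
  then have "ind (t ` A) X (q ` s ` A)" using a2 by simp
  moreover have "ind A X (s ` A)" using i1 by (auto intro: ind_subset)
  ultimately obtain w where w: "w \<in> stab X" "\<forall>x\<in>A. w x = t x" "\<forall>x\<in>s ` A. w x = q x"
    using amalgamate_maps[OF X t qX] by blast
  note wG = stab_in_G[OF w(1)]
  have "w y = y" if "y \<in> g ` X" for y
  proof -
    have "y \<in> s ` A" using that s(2) XA by force
    then have "w y = q y" using w(3) by blast
    then show ?thesis using q(3) that by simp
  qed
  then have "w \<in> stab (X \<union> g ` X)" using w(1) by (auto simp: stab_def)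
  then have "inv w \<in> stab (X \<union> g ` X)" by (rule stab_inv)
  moreover have "conj_by (inv w) g a = s a" if "a \<in> A" for a
  proof -
    have "w (s a) = g (w a)" using w(2,3) qs that by simp
    then have "inv w (g (w a)) = s a" using wG by (metis inv_left)
    then show ?thesis using wG by (simp add: conj_by_def)
  qed
  ultimately show ?thesis using that by blast
qed

text \<open>
  Almost maximal motion makes the image of \<open>A\<close> under a conjugate independent from \<open>A\<close> over
  \<open>Y0\<close> and \<open>Y1\<close>, and a further conjugation over \<open>A\<close> makes it independent from \<open>Y2\<close> as well.
  The independence of \<open>Y0\<close> and \<open>Y2\<close> over \<open>Y1\<close> allows \<open>Y0\<close> to be dropped from the base.
\<close>

lemma conjugate_spread:
  assumes g: "g \<in> G" "moves_almost_maximally g"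
    and i: "ind Y0 Y1 Y2" and A: "small A" "Y0 \<union> Y1 \<subseteq> A"
  obtains k where "k \<in> stab (Y0 \<union> Y1)" "ind (conj_by k g ` A) Y1 Y2"
proof -
  define B where "B = hull (Y0 \<union> Y1)"
  have Y: "small Y0" "small Y1" "small Y2" using ind_small i by auto
  have B: "flat B" unfolding B_def using Y by (intro flat_hull small_Un)
  have YB: "Y0 \<union> Y1 \<subseteq> B" unfolding B_def by (rule hull_extensive)
  obtain u where u: "u \<in> stab B" "ind (u ` A) B (g ` u ` A)"
    using g(2) A(1) B unfolding moves_almost_maximally_def by blast
  note uG = stab_in_G[OF u(1)]
  define A' where "A' = inv u ` g ` u ` A"
  have "ind (inv u ` u ` A) (inv u ` B) A'"
    unfolding A'_def using ind_image[OF G_inv[OF uG] u(2)] .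
  then have iA': "ind A B A'"
    using uG stab_image[OF stab_inv[OF u(1)] order_refl] by simp
  obtain w where w: "w \<in> stab (hull A)" "ind (w ` A') (hull A) Y2"
    using existence_stab flat_hull ind_small iA' A(1) Y(3) by metis
  have AB: "A \<subseteq> hull A" "B \<subseteq> hull A"
    using A(2) hull_extensive hull_mono unfolding B_def by blast+
  have "ind (w ` A) (w ` B) (w ` A')" using ind_image[OF stab_in_G[OF w(1)] iA'] .
  then have "ind (w ` A') B A"
    using stab_image[OF w(1)] AB by (auto intro: ind_sym)
  then have "ind (w ` A') B (hull A)"
    by (rule ind_mono) (simp_all add: subset_hull hull_mono)
  then have "ind (w ` A') B Y2" using ind_trans AB(2) w(2) by blast
  then have j: "ind Y2 B (w ` A')" by (rule ind_sym)
  have "ind Y2 Y1 B"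
    by (rule ind_mono[OF ind_sym[OF i]]) (use subset_hull in \<open>auto simp: B_def Un_commute\<close>)
  then have "ind Y2 Y1 (w ` A')" using ind_trans j YB by blast
  then have c: "ind (w ` A') Y1 Y2" by (rule ind_sym)
  define k where "k = w \<circ> inv u"
  have wA: "inv w a = a" if "a \<in> A" for a
    using stab_fixes[OF stab_inv[OF w(1)]] AB that by blast
  have "conj_by k g ` A = w ` A'"
    unfolding A'_def image_image using wA uG stab_in_G[OF w(1)]
    by (intro image_cong) (auto simp: k_def conj_by_def inv_comp_G G_inv)
  moreover have "w \<in> stab (Y0 \<union> Y1)" "inv u \<in> stab (Y0 \<union> Y1)"
    using stab_antimono w(1) stab_inv[OF u(1)] subset_trans[OF YB AB(2)] YB by blast+
  then have "k \<in> stab (Y0 \<union> Y1)" unfolding k_def by (rule stab_comp)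
  ultimately show ?thesis using that c by simp
qed

text \<open>
  The values of \<open>f\<close> on \<open>S\<close> are reached by spreading from both ends: the first factor sends a
  set \<open>A\<close> above \<open>S\<close> to a set \<open>A1\<close> that is independent from \<open>Y2\<close> over \<open>Y1\<close>, and the inverse
  of the last factor sends \<open>f ` A\<close> to a set \<open>A3\<close> that is independent from \<open>Y2\<close> over \<open>Y3\<close>.
  The image of \<open>A1\<close> in the middle is chosen independent from everything over \<open>Y2\<close>, so that
  the second factor and the inverse of the third one can be matched with it.
\<close>

lemma chain_extension:
  assumes h: "h1 \<in> G" "h2 \<in> G" "h3 \<in> G" "h4 \<in> G"
    and m: "moves_almost_maximally h1" "moves_almost_maximally h2"
      "moves_almost_maximally (inv h3)" "moves_almost_maximally (inv h4)"
    and Y0: "flat Y0"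
    and Y: "Y1 = h1 ` Y0" "Y2 = h2 ` Y1" "Y3 = h3 ` Y2" "Y4 = h4 ` Y3"
    and i: "ind Y0 Y1 Y2" "ind Y4 Y3 Y2"
    and f: "f \<in> G" "\<forall>x\<in>Y0. f x = h4 (h3 (h2 (h1 x)))"
    and S: "small S"
  obtains k1 k2 k3 k4 where "k1 \<in> stab (Y0 \<union> Y1)" "k2 \<in> stab (Y1 \<union> Y2)"
    "k3 \<in> stab (Y2 \<union> Y3)" "k4 \<in> stab (Y3 \<union> Y4)"
    "\<forall>x\<in>S. conj_by k4 h4 (conj_by k3 h3 (conj_by k2 h2 (conj_by k1 h1 x))) = f x"
proof -
  have fl: "flat Y1" "flat Y2" "flat Y3" "flat Y4"
    using Y0 h by (simp_all add: Y flat_image)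
  note sm = fl[THEN flat_small] flat_small[OF Y0]
  define A where "A = S \<union> Y0 \<union> Y1 \<union> inv f ` (Y3 \<union> Y4)"
  have A: "small A" unfolding A_def using S sm f(1) by (intro small_Un small_image G_inv) auto
  have fA: "small (f ` A)" using A f(1) by (simp add: small_image)
  have fA': "Y4 \<union> Y3 \<subseteq> f ` A" 
    using image_mono[of "inv f ` (Y3 \<union> Y4)" A f] f(1) by (auto simp: A_def)
  obtain k1 where k1: "k1 \<in> stab (Y0 \<union> Y1)" and A1: "ind (conj_by k1 h1 ` A) Y1 Y2"
    using conjugate_spread[OF h(1) m(1) i(1) A] by (auto simp: A_def)
  obtain k4 where k4: "k4 \<in> stab (Y4 \<union> Y3)" and A3: "ind (conj_by k4 (inv h4) ` f ` A) Y3 Y2"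
    using conjugate_spread[OF G_inv[OF h(4)] m(4) i(2) fA fA'] by blast
  define j1 where "j1 = conj_by k1 h1"
  define j4 where "j4 = conj_by k4 h4"
  have jG: "j1 \<in> G" "j4 \<in> G"
    using k1 k4 h by (auto simp: j1_def j4_def intro: conj_by_in_G stab_in_G)
  have j4i: "conj_by k4 (inv h4) = inv j4"
    using inv_conj_by[OF stab_in_G[OF k4] h(4)] by (simp add: j4_def)
  define A1 where "A1 = j1 ` A"
  define A3 where "A3 = inv j4 ` f ` A"
  have iA1: "ind A1 Y1 Y2" and iA3: "ind A3 Y3 Y2"
    using A1 A3 by (simp_all add: A1_def A3_def j1_def j4i)
  have j1Y: "j1 x = h1 x" if "x \<in> Y0" for x
  proof -
    have "inv k1 x = x" "k1 (h1 x) = h1 x"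
      using that k1 stab_inv[OF k1] by (auto simp: stab_def Y)
    then show ?thesis by (simp add: j1_def conj_by_def)
  qed
  have j4Y: "j4 x = h4 x" if "x \<in> Y3" for x
  proof -
    have "inv k4 x = x" "k4 (h4 x) = h4 x"
      using that k4 stab_inv[OF k4] by (auto simp: stab_def Y)
    then show ?thesis by (simp add: j4_def conj_by_def)
  qed
  \<comment> \<open>What remains for the second and third factor together.\<close>
  define \<theta> where "\<theta> = inv j4 \<circ> f \<circ> inv j1"
  have \<theta>: "\<theta> \<in> G" using jG f(1) by (simp add: \<theta>_def G_comp G_inv)
  have \<theta>A: "\<theta> ` A1 = A3"
    using jG by (simp add: \<theta>_def A1_def A3_def image_image)
  have \<theta>Y: "\<theta> y = h3 (h2 y)" if y: "y \<in> Y1" for y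
  proof -
    obtain x where x: "x \<in> Y0" "y = h1 x" using y Y(1) by blast
    have "inv j1 y = x" using j1Y[OF x(1)] x(2) jG by (metis inv_left)
    moreover have "f x = j4 (h3 (h2 y))"
      using f(2) x j4Y[of "h3 (h2 y)"] by (simp add: Y)
    ultimately show ?thesis using jG by (simp add: \<theta>_def)
  qed
  have sA: "small A1" "small A3" using iA1 iA3 ind_small by auto
  have YA: "Y1 \<subseteq> A1" "Y3 \<subseteq> A3"
  proof -
    show "Y1 \<subseteq> A1" using j1Y by (force simp: A1_def A_def Y)
    have "inv j4 ` Y4 = Y3"
    proof -
      have "Y4 = j4 ` Y3" using j4Y by (simp add: Y)
      then show ?thesis using jG by simp
    qed
    then show "Y3 \<subseteq> A3" using fA' by (auto simp: A3_def)
  qed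
  obtain v where v: "v \<in> stab Y2" and iv: "ind (v ` h2 ` A1) Y2 (A1 \<union> A3)"
    using existence_stab[of "h2 ` A1" Y2 "A1 \<union> A3"] fl(2) sA h(2) small_Un small_image by metis
  define s where "s = v \<circ> h2"
  define r where "r = s \<circ> inv \<theta>"
  have sG: "s \<in> G" "r \<in> G" using v h(2) \<theta> by (auto simp: s_def r_def stab_def intro!: G_comp G_inv)
  have sA1: "v ` h2 ` A1 = s ` A1" by (simp add: s_def image_comp)
  have rA3: "r ` A3 = s ` A1" using \<theta> by (simp add: r_def \<theta>A[symmetric] image_image)
  have sY: "s y = h2 y" if "y \<in> Y1" for y
    using that stab_fixes[OF v] by (simp add: s_def Y)
  have Y2': "Y2 = inv h3 ` Y3" using h(3) by (simp add: Y)
  have rY: "r y = inv h3 y" if y: "y \<in> Y3" for y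
  proof -
    obtain z where z: "z \<in> Y1" "y = h3 (h2 z)" using y Y by blast
    then have "inv \<theta> y = z" using \<theta>Y \<theta> by (metis inv_left)
    then show ?thesis using sY z h by (simp add: r_def)
  qed
  \<comment> \<open>The middle set is independent from both neighbours over Y2, so adding it to Y2 does not
      disturb the independence of a neighbour from Y2.\<close>
  have widen: "ind X Y (Y2 \<union> s ` A1)" if X: "ind X Y Y2" and YX: "Y \<subseteq> X" and XA: "X \<subseteq> A1 \<union> A3" for X Y
  proof -
    have "ind (s ` A1) Y2 X" using iv[unfolded sA1] by (rule ind_subset) (use XA in auto)
    then have "ind (s ` A1) (Y \<union> Y2) X"
      by (rule ind_base) (blast, rule subset_hull, use YX in blast)
    then have "ind X (Y \<union> Y2) (s ` A1)" by (rule ind_sym)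
    then have "ind X (Y \<union> Y2) (Y2 \<union> s ` A1)" by (rule ind_subset) auto
    moreover have "ind X Y (Y \<union> Y2)" using X by (rule ind_subset) auto
    ultimately show ?thesis using ind_trans by blast
  qed
  have "ind A1 Y1 (h2 ` Y1 \<union> s ` A1)"
    using widen[OF iA1 YA(1)] by (simp add: Y(2)[symmetric])
  moreover have "ind (s ` A1) (h2 ` Y1) Y1"
    unfolding Y(2)[symmetric] using iv[unfolded sA1] by (rule ind_subset) (use YA in auto)
  ultimately obtain k2 where k2: "k2 \<in> stab (Y1 \<union> h2 ` Y1)" "\<forall>a\<in>A1. conj_by k2 h2 a = s a"
    using conjugate_matching[OF h(2) m(2) fl(1) sG(1) _ YA(1)] sY by blast
  have "ind A3 Y3 (inv h3 ` Y3 \<union> r ` A3)"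
    using widen[OF iA3 YA(2)] by (simp add: Y2'[symmetric] rA3)
  moreover have "ind (r ` A3) (inv h3 ` Y3) Y3"
    unfolding Y2'[symmetric] rA3 using iv[unfolded sA1] by (rule ind_subset) (use YA in auto)
  ultimately obtain k3 where k3: "k3 \<in> stab (Y3 \<union> inv h3 ` Y3)" "\<forall>a\<in>A3. conj_by k3 (inv h3) a = r a"
    using conjugate_matching[OF G_inv[OF h(3)] m(3) fl(3) sG(2) _ YA(2)] rY by blast
  have k3G: "k3 \<in> G" using k3 stab_in_G by blast
  have "conj_by k4 h4 (conj_by k3 h3 (conj_by k2 h2 (conj_by k1 h1 x))) = f x" if "x \<in> S" for x
  proof -
    let ?a = "j1 x"
    have a: "?a \<in> A1" using that by (auto simp: A1_def A_def)
    then have "conj_by k2 h2 ?a = s ?a" using k2 by simp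
    moreover have "s ?a = r (\<theta> ?a)" using \<theta> by (simp add: r_def)
    moreover have "r (\<theta> ?a) = inv (conj_by k3 h3) (\<theta> ?a)"
      using k3(2) a \<theta>A inv_conj_by[OF k3G h(3)] by auto
    ultimately have "conj_by k3 h3 (conj_by k2 h2 ?a) = \<theta> ?a"
      using conj_by_in_G[OF k3G h(3)] by simp
    then have "j4 (conj_by k3 h3 (conj_by k2 h2 (j1 x))) = f x"
      using jG by (simp add: \<theta>_def)
    then show ?thesis by (simp add: j1_def j4_def)
  qed
  then show ?thesis
    using that[of k1 k2 k3 k4] k1 k2(1) k3(1) k4
    by (simp add: Y(2)[symmetric] Y2'[symmetric] Un_commute)
qed

section \<open>Products of four conjugates\<close>

text \<open>
  Only the four conjugating automorphisms with index below 4 matter; the factor with index 0 acts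
  first.
\<close>

definition word :: "('a \<Rightarrow> 'a) \<Rightarrow> (nat \<Rightarrow> 'a \<Rightarrow> 'a) \<Rightarrow> 'a \<Rightarrow> 'a" where
  "word g k = conj_by (k 3) g \<circ> conj_by (k 2) g \<circ> conj_by (k 1) g \<circ> conj_by (k 0) g"

text \<open>
  A basic neighbourhood of the tuple \<open>k\<close>: the condition says that each \<open>l i\<close> differs from \<open>k i\<close>
  by a left factor fixing \<open>Z\<close> pointwise. In this form it implies that \<open>l i\<close> and \<open>k i\<close> agree at
  every point that \<open>k i\<close> takes into \<open>Z\<close>, and that they conjugate \<open>g\<close> to maps that agree
  wherever argument and value are in \<open>Z\<close>.
\<close>

definition near :: "'a set \<Rightarrow> (nat \<Rightarrow> 'a \<Rightarrow> 'a) \<Rightarrow> (nat \<Rightarrow> 'a \<Rightarrow> 'a) \<Rightarrow> bool" where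
  "near Z k l \<longleftrightarrow> (\<forall>i<4. k i \<in> G \<and> l i \<in> G \<and> (\<forall>x\<in>Z. inv (l i) x = inv (k i) x))"

text \<open>
  The words of tuples near \<open>k\<close> are dense in the open set of all elements of \<open>G\<close> that agree with the
  word of \<open>k\<close> on \<open>Y\<close>.
\<close>

definition dense_near ::
  "('a \<Rightarrow> 'a) \<Rightarrow> 'a set \<Rightarrow> 'a set \<Rightarrow> (nat \<Rightarrow> 'a \<Rightarrow> 'a) \<Rightarrow> bool" where
  "dense_near g Z Y k \<longleftrightarrow>
     (\<forall>w\<in>G. (\<forall>x\<in>Y. w x = word g k x) \<longrightarrow>
        (\<forall>S. small S \<longrightarrow> (\<exists>l. near Z k l \<and> (\<forall>x\<in>S. word g l x = w x))))"

lemma lt_four: "(\<forall>i<4. P i) \<longleftrightarrow> P 0 \<and> P 1 \<and> P 2 \<and> P (3::nat)"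
  by (auto simp: less_Suc_eq eval_nat_numeral)

lemma word_in_G: "g \<in> G \<Longrightarrow> \<forall>i<4. k i \<in> G \<Longrightarrow> word g k \<in> G"
  by (simp add: lt_four word_def G_comp conj_by_in_G)

lemma near_trans: "near Z k l \<Longrightarrow> near Z' l m \<Longrightarrow> Z \<subseteq> Z' \<Longrightarrow> near Z k m"
  unfolding near_def by (metis subsetD)

lemma near_stab:
  assumes "\<forall>i<4. v i \<in> stab Z \<and> k i \<in> G"
  shows "near Z k (\<lambda>i. v i \<circ> k i)"
proof -
  have "v i \<circ> k i \<in> G \<and> (\<forall>x\<in>Z. inv (v i \<circ> k i) x = inv (k i) x)" if "i < 4" for i
  proof -
    have v: "v i \<in> stab Z" and k: "k i \<in> G" using assms that by auto
    then show ?thesis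
      using stab_fixes[OF stab_inv[OF v]] stab_in_G[OF v] by (simp add: G_comp inv_comp_G)
  qed
  then show ?thesis using assms unfolding near_def by blast
qed

lemma near_apply:
  assumes "near Z k l" "i < 4" "k i x \<in> Z"
  shows "l i x = k i x"
proof -
  have "inv (l i) (k i x) = x" using assms by (simp add: near_def)
  then show ?thesis using assms(1,2) unfolding near_def by (metis inv_right)
qed

lemma near_conj_by:
  assumes "near Z k l" "i < 4" "x \<in> Z" "conj_by (k i) g x \<in> Z"
  shows "conj_by (l i) g x = conj_by (k i) g x"
proof -
  have "inv (l i) x = inv (k i) x" using assms by (simp add: near_def)
  then show ?thesis
    using near_apply[OF assms(1,2), of "g (inv (k i) x)"] assms(4) by (simp add: conj_by_def)
qed

lemma word_near:
  assumes "near Z k l"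
    and "x \<in> Z" "conj_by (k 0) g x \<in> Z" "conj_by (k 1) g (conj_by (k 0) g x) \<in> Z"
      "conj_by (k 2) g (conj_by (k 1) g (conj_by (k 0) g x)) \<in> Z" "word g k x \<in> Z"
  shows "word g l x = word g k x"
  using assms(2-) by (simp add: word_def near_conj_by[OF assms(1)])

text \<open>
  Every neighbourhood of a tuple contains one whose words are dense in an open set. The three
  middle sets of the chain are chosen above \<open>Z\<close>, so that stabilisers of two consecutive
  sets stay in the given neighbourhood. The two outer sets are then moved into independent
  position over their neighbours by varying the first and the last factor.
\<close>

lemma somewhere_dense:
  assumes g: "g \<in> G" "moves_almost_maximally g" "moves_almost_maximally (inv g)"
    and k: "\<forall>i<4. k i \<in> G" and Z: "flat Z"
  obtains k' Y where "near Z k k'" "flat Y" "Z \<subseteq> Y" "dense_near g Z Y k'"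
proof -
  note kk = k[unfolded lt_four]
  define h where "h i = conj_by (k i) g" for i
  have h: "h i \<in> G" if "i < 4" for i using k that g by (simp add: h_def conj_by_in_G)
  note hh = h[of 0, simplified] h[of 1, simplified] h[of 2, simplified] h[of 3, simplified]
  define Y1 where "Y1 = hull (Z \<union> inv (h 1) ` inv (h 2) ` Z)"
  define Y2 where "Y2 = h 1 ` Y1"
  define Y3 where "Y3 = h 2 ` Y2"
  have Y1: "flat Y1" unfolding Y1_def
    using flat_small[OF Z] hh by (intro flat_hull small_Un small_image G_inv) auto
  have Y2: "flat Y2" and Y3: "flat Y3" using Y1 hh by (simp_all add: Y2_def Y3_def flat_image)
  have ZY1: "Z \<subseteq> Y1" "inv (h 1) ` inv (h 2) ` Z \<subseteq> Y1"
    unfolding Y1_def by (rule subset_hull, simp)+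
  then have ZY3: "Z \<subseteq> Y3"
    using image_mono[OF image_mono[OF ZY1(2), of "h 1"], of "h 2"] hh by (simp add: Y2_def Y3_def)
  obtain a where a: "a \<in> stab Y1" "ind (a ` inv (h 0) ` Y1) Y1 Y2"
    using existence_stab[of "inv (h 0) ` Y1" Y1 Y2] Y1 Y2 hh flat_small small_image G_inv by metis
  obtain b where b: "b \<in> stab Y3" "ind (b ` h 3 ` Y3) Y3 Y2"
    using existence_stab[of "h 3 ` Y3" Y3 Y2] Y3 Y2 hh flat_small small_image by metis
  define Y0 where "Y0 = a ` inv (h 0) ` Y1"
  define Y4 where "Y4 = b ` h 3 ` Y3"
  define v where "v i = (if i = 0 then a else if i = 3 then b else id)" for i :: nat
  define k' where "k' i = v i \<circ> k i" for i
  have aZ: "a \<in> stab Z" and bZ: "b \<in> stab Z" and ab: "a \<in> G" "b \<in> G"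
    using a(1) b(1) stab_antimono[OF ZY1(1)] stab_antimono[OF ZY3] stab_in_G by auto
  then have near: "near Z k k'" unfolding k'_def
    using kk by (intro near_stab) (auto simp: lt_four v_def stab_def G_id)
  then have k': "\<forall>i<4. k' i \<in> G" by (simp add: near_def)
  note kk' = k'[unfolded lt_four]
  have c: "conj_by (k' 0) g = conj_by a (h 0)" "conj_by (k' 1) g = h 1"
    "conj_by (k' 2) g = h 2" "conj_by (k' 3) g = conj_by b (h 3)"
    using kk ab by (simp_all add: k'_def v_def h_def conj_by_comp)
  have Y0f: "flat Y0" using Y1 ab hh by (simp add: Y0_def flat_image G_inv)
  define Y where "Y = hull (Y0 \<union> Z)"
  have Yf: "flat Y" unfolding Y_def using Y0f Z flat_small by (intro flat_hull small_Un) auto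
  have Ysub: "Y0 \<subseteq> Y" "Z \<subseteq> Y" unfolding Y_def by (rule subset_hull, simp)+
  have im: "Y1 = conj_by (k' 0) g ` Y0" "Y2 = conj_by (k' 1) g ` Y1"
    "Y3 = conj_by (k' 2) g ` Y2" "Y4 = conj_by (k' 3) g ` Y3"
  proof -
    show "Y1 = conj_by (k' 0) g ` Y0"
      using ab hh stab_image[OF a(1) order_refl]
      unfolding c(1) unfolding Y0_def conj_by_def image_comp[symmetric] by simp
    show "Y4 = conj_by (k' 3) g ` Y3"
      using stab_image[OF stab_inv[OF b(1)] order_refl]
      unfolding c(4) unfolding Y4_def conj_by_def image_comp[symmetric] by simp
  qed (simp_all add: c[unfolded One_nat_def] Y2_def Y3_def)
  have mv: "conj_by (k' i) g \<in> G" "moves_almost_maximally (conj_by (k' i) g)"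
    "moves_almost_maximally (inv (conj_by (k' i) g))" if "i < 4" for i
    using k' g that
    by (simp_all add: conj_by_in_G conjugate_moves_almost_maximally inv_conj_by G_inv)
  have four: "(0::nat) < 4" "(1::nat) < 4" "(2::nat) < 4" "(3::nat) < 4" by simp_all
  have "dense_near g Z Y k'"
    unfolding dense_near_def
  proof (intro ballI impI allI)
    fix w S assume w: "w \<in> G" "\<forall>x\<in>Y. w x = word g k' x" and S: "small S"
    have wY: "\<forall>x\<in>Y0. w x = conj_by (k' 3) g (conj_by (k' 2) g (conj_by (k' 1) g (conj_by (k' 0) g x)))"
      using w(2) Ysub by (auto simp: word_def)
    obtain k1 k2 k3 k4 where ks: "k1 \<in> stab (Y0 \<union> Y1)" "k2 \<in> stab (Y1 \<union> Y2)"
      "k3 \<in> stab (Y2 \<union> Y3)" "k4 \<in> stab (Y3 \<union> Y4)"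
      "\<forall>x\<in>S. conj_by k4 (conj_by (k' 3) g) (conj_by k3 (conj_by (k' 2) g)
         (conj_by k2 (conj_by (k' 1) g) (conj_by k1 (conj_by (k' 0) g) x))) = w x"
      using chain_extension[OF mv(1)[OF four(1)] mv(1)[OF four(2)] mv(1)[OF four(3)]
          mv(1)[OF four(4)] mv(2)[OF four(1)] mv(2)[OF four(2)] mv(3)[OF four(3)]
          mv(3)[OF four(4)] Y0f im a(2)[folded Y0_def] b(2)[folded Y4_def] w(1) wY S] by blast
    define u where "u i = (if i = 0 then k1 else if i = 1 then k2 else if i = 2 then k3 else k4)"
      for i :: nat
    have uZ: "\<forall>i<4. u i \<in> stab Z \<and> k' i \<in> G"
      using ks(1-4) ZY1(1) ZY3 stab_antimono[of Z "Y0 \<union> Y1"] stab_antimono[of Z "Y1 \<union> Y2"]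
        stab_antimono[of Z "Y2 \<union> Y3"] stab_antimono[of Z "Y3 \<union> Y4"] kk'
      by (auto simp: lt_four u_def le_supI1 le_supI2)
    then have "near Z k' (\<lambda>i. u i \<circ> k' i)" by (rule near_stab)
    moreover have "word g (\<lambda>i. u i \<circ> k' i) x = w x" if "x \<in> S" for x
      using ks(5) that kk' ks(1-4)[THEN stab_in_G]
      by (simp add: word_def u_def conj_by_comp)
    ultimately show "\<exists>l. near Z k' l \<and> (\<forall>x\<in>S. word g l x = w x)" by blast
  qed
  then show ?thesis using that near Yf Ysub by blast
qed

text \<open>
  One step of the construction for a block of four conjugates: the word is made equal to \<open>w\<close> on
  \<open>S\<close>, this equality is preserved by adding all intermediate values to \<open>Z\<close>, and density is
  recovered for the smaller neighbourhood. Putting \<open>T\<close> and its images into \<open>Z'\<close> is what makes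
  the conjugating automorphisms converge to bijections.
\<close>

lemma refine_block:
  assumes g: "g \<in> G" "moves_almost_maximally g" "moves_almost_maximally (inv g)"
    and Z: "flat Z" and dn: "dense_near g Z Y k"
    and w: "w \<in> G" "\<forall>x\<in>Y. w x = word g k x" and S: "small S" and T: "small T"
  obtains k' Z' Y' where "near Z k k'" "flat Z'" "Z \<subseteq> Z'" "T \<subseteq> Z'"
    "\<forall>i<4. k' i ` T \<subseteq> Z'" "flat Y'" "Z' \<subseteq> Y'" "dense_near g Z' Y' k'"
    "\<forall>x\<in>S. word g k' x = w x"
proof -
  obtain l where l: "near Z k l" "\<forall>x\<in>S. word g l x = w x"
    using dn w S unfolding dense_near_def by blast
  have lG: "\<forall>i<4. l i \<in> G" using l(1) by (simp add: near_def)
  note ll = lG[unfolded lt_four]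
  define S1 where "S1 = conj_by (l 0) g ` S"
  define S2 where "S2 = conj_by (l 1) g ` S1"
  define S3 where "S3 = conj_by (l 2) g ` S2"
  define S4 where "S4 = conj_by (l 3) g ` S3"
  define U where "U = Z \<union> T \<union> (\<Union>i<4. l i ` T) \<union> S \<union> S1 \<union> S2 \<union> S3 \<union> S4"
  have "small (\<Union>i<n. l i ` T)" if "n \<le> 4" for n
    using that by (induction n) (auto simp: lessThan_Suc small_finite lG T intro!: small_Un small_image)
  then have "small U" unfolding U_def S4_def S3_def S2_def S1_def
    using flat_small[OF Z] T S g ll by (intro small_Un small_image conj_by_in_G) auto
  then have Z': "flat (hull U)" by (rule flat_hull)
  have U: "U \<subseteq> hull U" by (rule hull_extensive)
  obtain k' Y' where k': "near (hull U) l k'" "flat Y'" "hull U \<subseteq> Y'" "dense_near g (hull U) Y' k'"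
    using somewhere_dense[OF g lG Z'] by blast
  have "near Z k k'" using near_trans[OF l(1) k'(1)] U by (auto simp: U_def)
  moreover have "k' i ` T \<subseteq> hull U" if "i < 4" for i
  proof -
    have "l i ` T \<subseteq> U" using that unfolding U_def by blast
    then have "l i ` T \<subseteq> hull U" using U by blast
    then show ?thesis using near_apply[OF k'(1) that] by force
  qed
  moreover have "word g k' x = w x" if "x \<in> S" for x
  proof -
    have "x \<in> U" "conj_by (l 0) g x \<in> U" "conj_by (l 1) g (conj_by (l 0) g x) \<in> U"
      "conj_by (l 2) g (conj_by (l 1) g (conj_by (l 0) g x)) \<in> U" "word g l x \<in> U"
      using that by (auto simp: U_def S1_def S2_def S3_def S4_def word_def)
    then have "word g k' x = word g l x"
      using U by (intro word_near[OF k'(1)]) auto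
    then show ?thesis using l(2) that by simp
  qed
  ultimately show ?thesis
    using that[of k' "hull U" Y'] k' Z' U by (simp add: U_def)
qed

section \<open>Every automorphism is a product of eight conjugates\<close>

lemma limit_in_G:
  fixes q :: "nat \<Rightarrow> 'a \<Rightarrow> 'a"
  assumes q: "\<And>n. q n \<in> G"
    and Z: "\<And>n. Z n \<subseteq> Z (Suc n)"
    and step: "\<And>n x. x \<in> Z n \<Longrightarrow> inv (q (Suc n)) x = inv (q n) x"
    and exhaust: "\<And>x. \<exists>n. x \<in> Z n \<and> q n x \<in> Z n"
  obtains l where "l \<in> G" "\<And>x. \<exists>n. \<forall>m\<ge>n. q m x = l x"
    "\<And>x. \<exists>n. \<forall>m\<ge>n. inv (q m) x = inv l x"
proof -
  have mono: "Z n \<subseteq> Z m" if "n \<le> m" for n m using Z that by (simp add: lift_Suc_mono_le)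
  have inv_const: "inv (q m) x = inv (q n) x" if "n \<le> m" "x \<in> Z n" for n m x
    using that(1)
  proof (induction rule: dec_induct)
    case (step m)
    then have "x \<in> Z m" using mono that(2) by blast
    then show ?case using assms(3) step by simp
  qed simp
  have const: "q m x = q n x" if "n \<le> m" "q n x \<in> Z n" for n m x
  proof -
    have "inv (q m) (q n x) = x" using inv_const[OF that] q by simp
    then show ?thesis using q by (metis inv_right)
  qed
  have "\<forall>x. \<exists>n. x \<in> Z n \<and> q n x \<in> Z n" using exhaust by blast
  then obtain N where N: "\<And>x. x \<in> Z (N x) \<and> q (N x) x \<in> Z (N x)" by metis
  define l where "l x = q (N x) x" for x
  define l' where "l' x = inv (q (N x)) x" for x
  have l: "q m x = l x" if "N x \<le> m" for m x
    using const[OF that] N by (simp add: l_def)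
  have l': "inv (q m) x = l' x" if "N x \<le> m" for m x
    using inv_const[OF that] N by (simp add: l'_def)
  have 1: "l' (l x) = x" for x
    using l[of x "max (N x) (N (l x))"] l'[of "l x" "max (N x) (N (l x))"]
    by (metis inv_left max.cobounded1 max.cobounded2 q)
  have 2: "l (l' x) = x" for x
    using l[of "l' x" "max (N x) (N (l' x))"] l'[of x "max (N x) (N (l' x))"]
    by (metis inv_right max.cobounded1 max.cobounded2 q)
  have bij: "bij l" using 1 2 by (intro o_bij[of l']) (auto simp: fun_eq_iff)
  have inv_l: "inv l = l'" using 1 2 by (intro inv_equality) auto
  have "l \<in> G"
  proof (rule G_closed[OF bij])
    fix F :: "'a set" assume "finite F"
    then have "\<forall>x\<in>F. q (Max (insert 0 (N ` F))) x = l x" by (auto intro!: l)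
    then show "\<exists>u\<in>G. \<forall>x\<in>F. u x = l x" using q by blast
  qed
  then show ?thesis using that[of l] l l' inv_l by blast
qed

lemma word_limit:
  fixes k :: "nat \<Rightarrow> nat \<Rightarrow> 'a \<Rightarrow> 'a"
  assumes "\<And>i x. i < 4 \<Longrightarrow> \<exists>n. \<forall>m\<ge>n. k m i x = l i x"
    and "\<And>i x. i < 4 \<Longrightarrow> \<exists>n. \<forall>m\<ge>n. inv (k m i) x = inv (l i) x"
  shows "\<exists>n. \<forall>m\<ge>n. word g (k m) x = word g l x"
proof -
  have comp: "\<forall>x. \<exists>n. \<forall>m\<ge>n. (a m \<circ> b m) x = (a' \<circ> b') x"
    if ab: "\<forall>x. \<exists>n. \<forall>m\<ge>n. a m x = a' x" "\<forall>x. \<exists>n. \<forall>m\<ge>n. b m x = b' x"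
    for a b :: "nat \<Rightarrow> 'a \<Rightarrow> 'a" and a' b'
  proof
    fix x
    obtain n1 n2 where "\<forall>m\<ge>n1. b m x = b' x" "\<forall>m\<ge>n2. a m (b' x) = a' (b' x)"
      using ab by metis
    then have "\<forall>m\<ge>max n1 n2. (a m \<circ> b m) x = (a' \<circ> b') x" by simp
    then show "\<exists>n. \<forall>m\<ge>n. (a m \<circ> b m) x = (a' \<circ> b') x" by blast
  qed
  have c: "\<forall>x. \<exists>n. \<forall>m\<ge>n. conj_by (k m i) g x = conj_by (l i) g x" if "i < 4" for i
  proof -
    have 1: "\<forall>x. \<exists>n. \<forall>m\<ge>n. (k m i \<circ> g) x = (l i \<circ> g) x"
      using assms(1)[OF that] by simp
    have 2: "\<forall>x. \<exists>n. \<forall>m\<ge>n. inv (k m i) x = inv (l i) x"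
      using assms(2)[OF that] by blast
    show ?thesis unfolding conj_by_def using comp[OF 1 2] .
  qed
  have "\<forall>x. \<exists>n. \<forall>m\<ge>n. word g (k m) x = word g l x"
    unfolding word_def by (intro comp[OF comp[OF comp]] c) simp_all
  then show ?thesis by blast
qed

lemma word_conj:
  assumes "u \<in> G" "g \<in> G" "\<forall>i<4. k i \<in> G"
  shows "word g (\<lambda>i. u \<circ> k i) = conj_by u (word g k)"
  using assms by (auto simp: lt_four word_def fun_eq_iff conj_by_def inv_comp_G G_inv)

text \<open>
  Composing the tuple with \<open>u\<close> conjugates its words by \<open>u\<close>. The neighbourhood is preserved
  because the hull of the empty set is fixed by all of \<open>G\<close>.
\<close>

lemma dense_near_conj:
  assumes u: "u \<in> G" and g: "g \<in> G" and dn: "dense_near g (hull {}) Y k"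
    and k: "\<forall>i<4. k i \<in> G"
  shows "dense_near g (hull {}) (u ` Y) (\<lambda>i. u \<circ> k i)"
  unfolding dense_near_def
proof (intro ballI impI allI)
  fix w S assume w: "w \<in> G" "\<forall>x\<in>u ` Y. w x = word g (\<lambda>i. u \<circ> k i) x" and S: "small S"
  have "inv u \<circ> w \<circ> u \<in> G" using u w(1) by (simp add: G_comp G_inv)
  moreover have "\<forall>x\<in>Y. (inv u \<circ> w \<circ> u) x = word g k x"
    using w(2) u by (simp add: word_conj[OF u g k] conj_by_def)
  moreover have "small (inv u ` S)" using u S by (simp add: small_image G_inv)
  ultimately obtain l where l: "near (hull {}) k l"
      "\<forall>x\<in>inv u ` S. word g l x = (inv u \<circ> w \<circ> u) x"
    using dn unfolding dense_near_def by blast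
  then have lG: "\<forall>i<4. l i \<in> G" by (simp add: near_def)
  have "near (hull {}) (\<lambda>i. u \<circ> k i) (\<lambda>i. u \<circ> l i)"
    using l(1) u G_fixes[OF G_inv[OF u]] by (simp add: near_def inv_comp_G G_comp)
  moreover have "\<forall>x\<in>S. word g (\<lambda>i. u \<circ> l i) x = w x"
    using l(2) u by (simp add: word_conj[OF u g lG] conj_by_def)
  ultimately show "\<exists>l. near (hull {}) (\<lambda>i. u \<circ> k i) l \<and> (\<forall>x\<in>S. word g l x = w x)"
    by blast
qed

text \<open>
  Both blocks of four conjugates are refined in turn. The invariant is that \<open>f\<close> can still be
  split as a product \<open>(f \<circ> inv w) \<circ> w\<close> whose right factor lies in the open set where the words
  of the first block are dense, and whose left factor lies in the one of the second block. When the
  first block has been brought close enough to \<open>w\<close>, replacing \<open>w\<close> by its actual word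
  changes the left factor only outside the set that matters to the second block, and conversely.
\<close>

theorem eight_conjugates:
  assumes count: "countable (UNIV :: 'a set)"
    and g: "g \<in> G" "moves_almost_maximally g" "moves_almost_maximally (inv g)"
    and f: "f \<in> G"
  obtains k l where "\<forall>i<4. k i \<in> G \<and> l i \<in> G" "f = word g l \<circ> word g k"
proof -
  define B where "B = hull {}"
  have B: "flat B" unfolding B_def by (intro flat_hull small_finite) simp
  obtain e :: "nat \<Rightarrow> 'a" where e: "range e = UNIV"
    using count range_from_nat_into by blast
  define inv_state where "inv_state = (\<lambda>(k, Z, Y, l, Z', Y').
    flat Z \<and> flat Z' \<and> flat Y \<and> flat Y' \<and> (\<forall>i<4. k i \<in> G \<and> l i \<in> G)
    \<and> dense_near g Z Y k \<and> dense_near g Z' Y' l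
    \<and> (\<exists>w\<in>G. (\<forall>x\<in>Y. w x = word g k x) \<and> (\<forall>x\<in>Y'. f (inv w x) = word g l x)))"
  define next_state where "next_state n = (\<lambda>(k, Z, Y :: 'a set, l, Z', Y' :: 'a set)
      (k1, Z1, Y1 :: 'a set, l1, Z1', Y1' :: 'a set).
    near Z k k1 \<and> near Z' l l1 \<and> Z \<subseteq> Z1 \<and> Z' \<subseteq> Z1' \<and> e n \<in> Z1 \<and> e n \<in> Z1'
    \<and> (\<forall>i<4. k1 i (e n) \<in> Z1 \<and> l1 i (e n) \<in> Z1') 
    \<and> (\<forall>x\<in>Z1. f x = word g l1 (word g k1 x)))" for n :: nat
  have start: "\<exists>s. inv_state s"
  proof -
    obtain k Y where k: "near B (\<lambda>_. id) k" "flat Y" "B \<subseteq> Y" "dense_near g B Y k"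
      using somewhere_dense[OF g, of "\<lambda>_. id" B] B G_id by blast
    have kG: "\<forall>i<4. k i \<in> G" using k(1) by (simp add: near_def)
    define p where "p = word g k"
    have p: "p \<in> G" using word_in_G[OF g(1) kG] by (simp add: p_def)
    have sm: "small Y" "small (p ` Y)" "small (f ` Y)"
      using flat_small[OF k(2)] p f by (simp_all add: small_image)
    have stabB: "h \<in> stab B" if "h \<in> G" for h
      using that G_fixes by (simp add: stab_def B_def)
    have BG: "h ` B = B" if "h \<in> G" for h using stab_image[OF stabB[OF that] order_refl] .
    \<comment> \<open>The same block serves twice, the second time conjugated by a generic u. Then the
        conditions on w, one from each block, concern independent sets and amalgamate.\<close>
    obtain u where u: "u \<in> stab B" "ind (u ` (Y \<union> p ` Y)) B (p ` Y \<union> f ` Y)"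
      using existence_stab[OF small_Un[OF sm(1,2)] B small_Un[OF sm(2,3)]] by blast
    note uG = stab_in_G[OF u(1)]
    define q where "q = u \<circ> inv p \<circ> inv u \<circ> f"
    have q: "q \<in> G" using uG p f by (simp add: q_def G_comp G_inv)
    define C where "C = inv f ` u ` p ` Y"
    have "ind (u ` p ` Y) B (f ` Y)" using u(2) by (rule ind_subset) auto
    then have "ind (inv f ` u ` p ` Y) (inv f ` B) (inv f ` f ` Y)"
      using G_inv[OF f] by (rule ind_image[rotated])
    then have 1: "ind Y B C" using f BG[OF G_inv[OF f]] by (auto simp: C_def intro: ind_sym)
    have "q ` C = u ` Y" unfolding q_def C_def image_comp[symmetric] using f uG p by simp
    moreover have "ind (u ` Y) B (p ` Y)" using u(2) by (rule ind_subset) auto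
    ultimately have "ind (p ` Y) B (q ` C)" by (auto intro: ind_sym)
    then obtain w where w: "w \<in> stab B" "\<forall>x\<in>Y. w x = p x" "\<forall>x\<in>C. w x = q x"
      using amalgamate_maps[OF B stabB[OF p] stabB[OF q] 1] by blast
    note wG = stab_in_G[OF w(1)]
    have "f (inv w (u y)) = u (p y)" if "y \<in> Y" for y
    proof -
      define c where "c = inv f (u (p y))"
      have "w c = u y" using w(3) that f uG p by (simp add: c_def C_def q_def)
      then have "inv w (u y) = c" using wG by (metis inv_left)
      then show ?thesis using f by (simp add: c_def)
    qed
    then have "\<forall>x\<in>u ` Y. f (inv w x) = word g (\<lambda>i. u \<circ> k i) x"
      using uG by (simp add: word_conj[OF uG g(1) kG] conj_by_def p_def)
    moreover have "flat (u ` Y)" using k(2) uG by (rule flat_image)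
    moreover have "dense_near g B (u ` Y) (\<lambda>i. u \<circ> k i)"
      using dense_near_conj[OF uG g(1)] k(4) kG by (simp add: B_def)
    ultimately have "inv_state (k, B, Y, \<lambda>i. u \<circ> k i, B, u ` Y)"
      using B k kG uG wG w(2) by (auto simp: inv_state_def p_def G_comp)
    then show ?thesis by blast
  qed
  have step: "\<exists>s'. inv_state s' \<and> next_state n s s'" if "inv_state s" for s n
  proof -
    obtain k Z Y l Z' Y' where s: "s = (k, Z, Y, l, Z', Y')" by (cases s) 
    then have Z: "flat Z" "flat Z'" and Y: "flat Y" "flat Y'" and kl: "\<forall>i<4. k i \<in> G \<and> l i \<in> G"
      and dn: "dense_near g Z Y k" "dense_near g Z' Y' l"
      and "\<exists>w\<in>G. (\<forall>x\<in>Y. w x = word g k x) \<and> (\<forall>x\<in>Y'. f (inv w x) = word g l x)"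
      using that by (simp_all add: inv_state_def)
    then obtain w where w: "w \<in> G" "\<forall>x\<in>Y. w x = word g k x" "\<forall>x\<in>Y'. f (inv w x) = word g l x"
      by blast
    have T: "small {e n}" by (simp add: small_finite)
    \<comment> \<open>A word that agrees with w on this set has an inverse that agrees with inv w on Y'.\<close>
    have S: "small (inv w ` Y')" using w(1) flat_small[OF Y(2)] by (simp add: small_image G_inv)
    obtain k1 Z1 Y1 where k1: "near Z k k1" "flat Z1" "Z \<subseteq> Z1" "{e n} \<subseteq> Z1"
      "\<forall>i<4. k1 i ` {e n} \<subseteq> Z1" "flat Y1" "Z1 \<subseteq> Y1" "dense_near g Z1 Y1 k1"
      "\<forall>x\<in>inv w ` Y'. word g k1 x = w x"
      using refine_block[OF g Z(1) dn(1) w(1,2) S T] by blast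
    have kG: "\<forall>i<4. k1 i \<in> G" using k1(1) by (simp add: near_def)
    define p where "p = word g k1"
    have p: "p \<in> G" using word_in_G[OF g(1) kG] by (simp add: p_def)
    have fp: "f \<circ> inv p \<in> G" using f p by (simp add: G_comp G_inv)
    have fpY: "\<forall>y\<in>Y'. (f \<circ> inv p) y = word g l y"
    proof
      fix y assume y: "y \<in> Y'"
      then have "p (inv w y) = y" using k1(9) w(1) by (simp add: p_def)
      then have "inv p y = inv w y" using p by (metis inv_left)
      then show "(f \<circ> inv p) y = word g l y" using w(3) y by simp
    qed
    have S': "small (p ` Y1)" using p flat_small[OF k1(6)] by (simp add: small_image)
    obtain l1 Z1' Y1' where l1: "near Z' l l1" "flat Z1'" "Z' \<subseteq> Z1'" "{e n} \<subseteq> Z1'"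
      "\<forall>i<4. l1 i ` {e n} \<subseteq> Z1'" "flat Y1'" "Z1' \<subseteq> Y1'" "dense_near g Z1' Y1' l1"
      "\<forall>x\<in>p ` Y1. word g l1 x = (f \<circ> inv p) x"
      using refine_block[OF g Z(2) dn(2) fp fpY S' T] by blast
    have lG: "\<forall>i<4. l1 i \<in> G" using l1(1) by (simp add: near_def)
    define r where "r = word g l1"
    have r: "r \<in> G" using word_in_G[OF g(1) lG] by (simp add: r_def)
    have fY1: "f x = r (p x)" if "x \<in> Y1" for x
      using l1(9) that p by (simp add: r_def)
    \<comment> \<open>With this choice the second block is exact, and w' agrees with the word p on Y1.\<close>
    define w' where "w' = inv r \<circ> f"
    have w': "w' \<in> G" using r f by (simp add: w'_def G_comp G_inv)
    have "w' x = p x" if "x \<in> Y1" for x using fY1[OF that] r by (simp add: w'_def)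
    moreover have "f (inv w' x) = r x" for x
      using r f by (simp add: w'_def inv_comp_G G_inv)
    ultimately have "inv_state (k1, Z1, Y1, l1, Z1', Y1')"
      using k1 l1 kG lG w' by (auto simp: inv_state_def p_def r_def)
    moreover have "next_state n s (k1, Z1, Y1, l1, Z1', Y1')"
      using k1 l1 fY1 by (auto simp: next_state_def s p_def r_def)
    ultimately show ?thesis by blast
  qed
  obtain st where st: "\<And>n. inv_state (st n)" "\<And>n. next_state n (st n) (st (Suc n))"
    using dependent_nat_choice[of "\<lambda>_. inv_state" next_state] start step by metis
  define K where "K n = fst (st n)" for n
  define Z where "Z n = fst (snd (st n))" for n
  define L where "L n = fst (snd (snd (snd (st n))))" for n
  define Z' where "Z' n = fst (snd (snd (snd (snd (st n)))))" for n
  have KL: "K n i \<in> G" "L n i \<in> G" if "i < 4" for n i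
    using st(1)[of n] that by (auto simp: inv_state_def K_def L_def split: prod.splits)
  have nx: "near (Z n) (K n) (K (Suc n))" "near (Z' n) (L n) (L (Suc n))"
    "Z n \<subseteq> Z (Suc n)" "Z' n \<subseteq> Z' (Suc n)" "e n \<in> Z (Suc n)" "e n \<in> Z' (Suc n)"
    "\<forall>i<4. K (Suc n) i (e n) \<in> Z (Suc n) \<and> L (Suc n) i (e n) \<in> Z' (Suc n)"
    "\<forall>x\<in>Z (Suc n). f x = word g (L (Suc n)) (word g (K (Suc n)) x)" for n
    using st(2)[of n]
    by (auto simp: next_state_def K_def L_def Z_def Z'_def split: prod.splits)
  have ex: "\<exists>n. x \<in> Z n \<and> K n i x \<in> Z n" "\<exists>n. x \<in> Z' n \<and> L n i x \<in> Z' n" if "i < 4" for i x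
  proof -
    obtain n where "x = e n" using e by (metis UNIV_I image_iff)
    then show "\<exists>n. x \<in> Z n \<and> K n i x \<in> Z n" "\<exists>n. x \<in> Z' n \<and> L n i x \<in> Z' n"
      using nx(5-7)[of n] that by blast+
  qed
  have "\<exists>l\<in>G. (\<forall>x. \<exists>n. \<forall>m\<ge>n. K m i x = l x) \<and> (\<forall>x. \<exists>n. \<forall>m\<ge>n. inv (K m i) x = inv l x)"
    if "i < 4" for i
    using limit_in_G[of "\<lambda>n. K n i" Z] KL(1)[OF that] nx(1,3) ex(1)[OF that] that
    unfolding near_def by metis
  then obtain k where k: "\<And>i. i < 4 \<Longrightarrow> k i \<in> G"
    "\<And>i x. i < 4 \<Longrightarrow> \<exists>n. \<forall>m\<ge>n. K m i x = k i x"
    "\<And>i x. i < 4 \<Longrightarrow> \<exists>n. \<forall>m\<ge>n. inv (K m i) x = inv (k i) x" by metis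
  have "\<exists>l\<in>G. (\<forall>x. \<exists>n. \<forall>m\<ge>n. L m i x = l x) \<and> (\<forall>x. \<exists>n. \<forall>m\<ge>n. inv (L m i) x = inv l x)"
    if "i < 4" for i
    using limit_in_G[of "\<lambda>n. L n i" Z'] KL(2)[OF that] nx(2,4) ex(2)[OF that] that
    unfolding near_def by metis
  then obtain l where l: "\<And>i. i < 4 \<Longrightarrow> l i \<in> G"
    "\<And>i x. i < 4 \<Longrightarrow> \<exists>n. \<forall>m\<ge>n. L m i x = l i x"
    "\<And>i x. i < 4 \<Longrightarrow> \<exists>n. \<forall>m\<ge>n. inv (L m i) x = inv (l i) x" by metis
  have "f x = word g l (word g k x)" for x
  proof -
    obtain n1 where n1: "\<forall>m\<ge>n1. word g (K m) x = word g k x"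
      using word_limit[of K k g x] k(2,3) by blast
    obtain n2 where n2: "\<forall>m\<ge>n2. word g (L m) (word g k x) = word g l (word g k x)"
      using word_limit[of L l g "word g k x"] l(2,3) by blast
    obtain n where n: "x = e n" using e by (metis UNIV_I image_iff)
    define m where "m = Max {n1, n2, n}"
    have m: "n1 \<le> Suc m" "n2 \<le> Suc m" "Suc n \<le> Suc m" by (auto simp: m_def)
    have "x \<in> Z (Suc m)"
      using nx(5)[of n] n lift_Suc_mono_le[of Z, OF nx(3) m(3)] by blast
    then show ?thesis using nx(8)[of m] n1 n2 m by simp
  qed
  then show ?thesis using that[of k l] k(1) l(1) by (simp add: fun_eq_iff)
qed

end

section \<open>Dimension functions\<close>

locale dimension_structure =
  fixes M :: "('f, 'r, 'a) fo_structure" and d :: "'a set \<Rightarrow> int"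
  assumes dim: "dimension_function M d"
begin

lemma d_mono: "finite Y \<Longrightarrow> X \<subseteq> Y \<Longrightarrow> d X \<le> d Y"
  using dimension_functionD(3)[OF dim, of X Y] by (simp add: Un_absorb1 finite_subset)

lemma d_submod: "finite X \<Longrightarrow> finite Y \<Longrightarrow> I \<subseteq> X \<inter> Y \<Longrightarrow> d (X \<union> Y) + d I \<le> d X + d Y"
  using dimension_functionD(4)[OF dim, of X Y] d_mono[of "X \<inter> Y" I] by simp

lemma d_image: "finite X \<Longrightarrow> u \<in> Aut M \<Longrightarrow> d (u ` X) = d X"
  using dim by (simp add: dimension_function_def)

lemma mem_cl: "a \<in> cl d Z \<longleftrightarrow> (\<exists>F. finite F \<and> F \<subseteq> Z \<and> d (insert a F) = d F)"
proof -
  let ?S = "{d ({a} \<union> Y) - d Y | Y. finite Y \<and> Y \<subseteq> Z}"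
  have fin: "finite ?S" by (rule fin_dim_over_set_finite[OF dim]) simp
  have ne: "?S \<noteq> {}" by blast
  have nonneg: "0 \<le> x" if "x \<in> ?S" for x
  proof -
    obtain Y where "x = d ({a} \<union> Y) - d Y" "finite Y" using \<open>x \<in> ?S\<close> by blast
    then show ?thesis using d_mono[of "{a} \<union> Y" Y] by auto
  qed
  have "Min ?S = 0 \<longleftrightarrow> 0 \<in> ?S"
  proof
    show "0 \<in> ?S" if "Min ?S = 0" using Min_in[OF fin ne] that by simp
    show "Min ?S = 0" if "0 \<in> ?S" using nonneg that by (intro Min_eqI[OF fin])
  qed
  also have "\<dots> \<longleftrightarrow> (\<exists>F. finite F \<and> F \<subseteq> Z \<and> d (insert a F) = d F)" by auto
  finally show ?thesis by (simp add: cl_def fin_dim_over_def)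
qed

lemma cl_extensive: "S \<subseteq> cl d S"
proof
  fix a assume "a \<in> S"
  then show "a \<in> cl d S" unfolding mem_cl by (intro exI[of _ "{a}"]) simp
qed

lemma cl_mono: "S \<subseteq> T \<Longrightarrow> cl d S \<subseteq> cl d T"
  unfolding mem_cl subset_iff by metis

lemma subset_cl: "S \<subseteq> T \<Longrightarrow> S \<subseteq> cl d T"
  using cl_extensive by blast

lemma d_insert_eq_mono:
  assumes "d (insert a F) = d F" "F \<subseteq> F'" "finite F'"
  shows "d (insert a F') = d F'"
proof -
  have "finite F" using assms(2,3) finite_subset by blast
  then have "d (insert a F \<union> F') + d F \<le> d (insert a F) + d F'"
    using assms by (intro d_submod) auto
  moreover have "insert a F \<union> F' = insert a F'" using assms(2) by blast
  ultimately show ?thesis using assms d_mono[of "insert a F'" F'] by fastforce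
qed

text \<open>
  A finite part of a closure adds no dimension to any sufficiently large finite set. The witnesses
  for the single points can be collected because they survive enlargement.
\<close>

lemma finite_subset_cl:
  assumes "finite P" "P \<subseteq> cl d Z"
  shows "\<exists>F. finite F \<and> F \<subseteq> Z \<and> (\<forall>F'. finite F' \<longrightarrow> F \<subseteq> F' \<longrightarrow> d (P \<union> F') = d F')"
  using assms
proof (induction P rule: finite_induct)
  case empty
  show ?case by (intro exI[of _ "{}"]) simp
next
  case (insert a P)
  obtain F where F: "finite F" "F \<subseteq> Z" "\<And>F'. finite F' \<Longrightarrow> F \<subseteq> F' \<Longrightarrow> d (P \<union> F') = d F'"
    using insert.IH insert.prems by auto
  obtain E where E: "finite E" "E \<subseteq> Z" "d (insert a E) = d E"
    using insert.prems mem_cl by (meson insert_subset)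
  show ?case
  proof (intro exI[of _ "F \<union> E"] conjI allI impI)
    fix F' assume F': "finite F'" "F \<union> E \<subseteq> F'"
    then have "d (insert a (P \<union> F')) = d (P \<union> F')"
      using insert.hyps by (intro d_insert_eq_mono[OF E(3)]) auto
    then show "d (insert a P \<union> F') = d F'" using F(3) F' by simp
  qed (use F E in auto)
qed

lemma cl_idem: "cl d (cl d S) = cl d S"
proof
  show "cl d (cl d S) \<subseteq> cl d S"
  proof
    fix a assume "a \<in> cl d (cl d S)"
    then obtain P where P: "finite P" "P \<subseteq> cl d S" "d (insert a P) = d P" using mem_cl by blast
    obtain F where F: "finite F" "F \<subseteq> S" "\<And>F'. finite F' \<Longrightarrow> F \<subseteq> F' \<Longrightarrow> d (P \<union> F') = d F'"
      using finite_subset_cl[OF P(1,2)] by blast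
    have "d (insert a F) \<le> d (insert a (P \<union> F))" using P F by (intro d_mono) auto
    also have "\<dots> = d (P \<union> F)" using P F by (intro d_insert_eq_mono[OF P(3)]) auto
    also have "\<dots> = d F" using F by simp
    finally have "d (insert a F) = d F" using d_mono[of "insert a F" F] F by fastforce
    then show "a \<in> cl d S" using mem_cl F by blast
  qed
qed (rule cl_extensive)

lemma cl_subset: "S \<subseteq> cl d T \<Longrightarrow> cl d S \<subseteq> cl d T"
  using cl_mono[of S "cl d T"] cl_idem by simp

lemma cl_image_subset: "u \<in> Aut M \<Longrightarrow> u ` cl d S \<subseteq> cl d (u ` S)"
proof
  fix b assume u: "u \<in> Aut M" "b \<in> u ` cl d S"
  then obtain a F where a: "b = u a" "finite F" "F \<subseteq> S" "d (insert a F) = d F"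
    using mem_cl by auto
  then have "d (insert b (u ` F)) = d (u ` F)"
    using d_image[OF _ u(1), of F] d_image[OF _ u(1), of "insert a F"] by simp
  then show "b \<in> cl d (u ` S)" unfolding mem_cl using a by (intro exI[of _ "u ` F"]) auto
qed

text \<open>
  Sets within the closure of a finite set are stable under subsets and unions, and \<open>d\<close> is bounded
  on their finite subsets, so that the maximum \<open>rk\<close> exists on them.
\<close>

definition small :: "'a set \<Rightarrow> bool" where
  "small S \<longleftrightarrow> (\<exists>F. finite F \<and> S \<subseteq> cl d F)"

definition rk :: "'a set \<Rightarrow> int" where
  "rk S = Max {d F | F. finite F \<and> F \<subseteq> S}"

lemma small_finite: "finite S \<Longrightarrow> small S"
  unfolding small_def using cl_extensive by blast

lemma small_subset: "small S \<Longrightarrow> T \<subseteq> S \<Longrightarrow> small T"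
  unfolding small_def by blast

lemma small_Un: "small S \<Longrightarrow> small T \<Longrightarrow> small (S \<union> T)"
proof -
  assume "small S" "small T"
  then obtain E F where "finite E" "finite F" "S \<subseteq> cl d E" "T \<subseteq> cl d F"
    unfolding small_def by blast
  moreover have "cl d E \<subseteq> cl d (E \<union> F)" "cl d F \<subseteq> cl d (E \<union> F)" by (simp_all add: cl_mono)
  ultimately show ?thesis unfolding small_def by (intro exI[of _ "E \<union> F"]) auto
qed

lemma small_cl: "small S \<Longrightarrow> small (cl d S)"
  unfolding small_def using cl_subset by blast

lemma rk_set_finite: "small S \<Longrightarrow> finite {d F | F. finite F \<and> F \<subseteq> S}"
proof -
  assume "small S"
  then obtain E where E: "finite E" "S \<subseteq> cl d E" unfolding small_def by blast
  have "d F \<in> {0..d E}" if F: "finite F" "F \<subseteq> S" for F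
  proof -
    obtain E' where "E' \<subseteq> E" "\<forall>F'. finite F' \<longrightarrow> E' \<subseteq> F' \<longrightarrow> d (F \<union> F') = d F'"
      using finite_subset_cl[of F E] F E(2) by blast
    then have "d (F \<union> E) = d E" using E(1) by blast
    then show ?thesis using d_mono[of "F \<union> E" F] F E(1) dimension_functionD(2)[OF dim] by simp
  qed
  then have "{d F | F. finite F \<and> F \<subseteq> S} \<subseteq> {0..d E}" by blast
  then show ?thesis using finite_subset by blast
qed

lemma rk_ge: "small S \<Longrightarrow> finite F \<Longrightarrow> F \<subseteq> S \<Longrightarrow> d F \<le> rk S"
  unfolding rk_def using rk_set_finite by (intro Max_ge) auto

lemma rk_witness:
  assumes "small S"
  obtains F where "finite F" "F \<subseteq> S" "d F = rk S"
proof -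
  have "Max {d F | F. finite F \<and> F \<subseteq> S} \<in> {d F | F. finite F \<and> F \<subseteq> S}"
    using rk_set_finite[OF assms] by (intro Max_in) auto
  then show ?thesis using that unfolding rk_def by auto
qed

lemma rk_mono: "small T \<Longrightarrow> S \<subseteq> T \<Longrightarrow> rk S \<le> rk T"
  by (metis rk_ge rk_witness small_subset subset_trans)

lemma rk_finite: "finite F \<Longrightarrow> rk F = d F"
  by (metis antisym d_mono order_refl rk_ge rk_witness small_finite)

text \<open>
  Submodularity passes from \<open>d\<close> to \<open>rk\<close>: take finite sets attaining the two ranks on the left
  and distribute them over the two sides.
\<close>

lemma rk_submod:
  assumes S: "small S" and T: "small T" and I: "I \<subseteq> S \<inter> T"
  shows "rk (S \<union> T) + rk I \<le> rk S + rk T"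
proof -
  have "small I" using small_subset S I by blast
  then obtain J where J: "finite J" "J \<subseteq> I" "d J = rk I" by (rule rk_witness)
  obtain X where X: "finite X" "X \<subseteq> S \<union> T" "d X = rk (S \<union> T)"
    using rk_witness[OF small_Un[OF S T]] by blast
  let ?S = "X \<inter> S \<union> J" and ?T = "X \<inter> T \<union> J"
  have "d (?S \<union> ?T) + d J \<le> d ?S + d ?T" using X J by (intro d_submod) auto
  moreover have "d X \<le> d (?S \<union> ?T)" using X J by (intro d_mono) auto
  moreover have "d ?S \<le> rk S" using X(1) J I by (intro rk_ge S) auto
  moreover have "d ?T \<le> rk T" using X(1) J I by (intro rk_ge T) auto
  ultimately show ?thesis using X J by simp
qed

lemma rk_between:
  assumes "small S" "S \<subseteq> T" "T \<subseteq> cl d S"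
  shows "rk T = rk S"
proof (rule antisym)
  have T: "small T" using assms small_cl small_subset by blast
  obtain P where P: "finite P" "P \<subseteq> T" "d P = rk T" using rk_witness[OF T] by blast
  obtain F where F: "finite F" "F \<subseteq> S" "\<And>F'. finite F' \<Longrightarrow> F \<subseteq> F' \<Longrightarrow> d (P \<union> F') = d F'"
    using finite_subset_cl[of P S] P assms(3) by blast
  have "d P \<le> d (P \<union> F)" using P F by (intro d_mono) auto
  also have "\<dots> = d F" using F by simp
  also have "\<dots> \<le> rk S" using F assms(1) by (intro rk_ge)
  finally show "rk T \<le> rk S" using P by simp
  show "rk S \<le> rk T" using T assms(2) by (rule rk_mono)
qed

text \<open>
  Closure of a small set in terms of rank, which makes membership accessible to the linear
  arithmetic of independence.
\<close>

lemma mem_cl_rk: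
  assumes "small Z"
  shows "a \<in> cl d Z \<longleftrightarrow> rk (insert a Z) = rk Z"
proof
  assume "a \<in> cl d Z"
  then show "rk (insert a Z) = rk Z" using rk_between[OF assms, of "insert a Z"] cl_extensive by auto
next
  assume eq: "rk (insert a Z) = rk Z"
  obtain F where F: "finite F" "F \<subseteq> Z" "d F = rk Z" using rk_witness[OF assms] by blast
  have "small (insert a Z)" using small_Un[OF small_finite[of "{a}"] assms] by simp
  then have "d (insert a F) \<le> rk (insert a Z)" using F by (intro rk_ge) auto
  then have "d (insert a F) = d F" using eq F d_mono[of "insert a F" F] by fastforce
  then show "a \<in> cl d Z" using mem_cl F by blast
qed

section \<open>Independence in terms of rank\<close>

definition ind :: "'a set \<Rightarrow> 'a set \<Rightarrow> 'a set \<Rightarrow> bool" where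
  "ind A B C \<longleftrightarrow> small A \<and> small B \<and> small C
     \<and> rk (A \<union> B \<union> C) + rk B = rk (A \<union> B) + rk (B \<union> C)"

text \<open>
  The other inequality always holds by submodularity.
\<close>

lemma ind_iff_ge:
  assumes "small A" "small B" "small C"
  shows "ind A B C \<longleftrightarrow> rk (A \<union> B) + rk (B \<union> C) \<le> rk (A \<union> B \<union> C) + rk B"
proof -
  have "A \<union> B \<union> (B \<union> C) = A \<union> B \<union> C" by blast
  then have "rk (A \<union> B \<union> C) + rk B \<le> rk (A \<union> B) + rk (B \<union> C)"
    using rk_submod[of "A \<union> B" "B \<union> C" B] assms small_Un by auto
  then show ?thesis using assms unfolding ind_def by auto
qed

lemma ind_sym: "ind A B C \<Longrightarrow> ind C B A"
  unfolding ind_def by (simp add: Un_ac)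

text \<open>
  Passing to the hulls \<open>P\<close> of \<open>A \<union> B\<close> and \<open>Q\<close> of \<open>B \<union> C\<close> changes no rank, and two
  applications of submodularity cut \<open>Q\<close> down to \<open>B \<union> C'\<close> and then \<open>P\<close> down to \<open>A' \<union> B\<close>.
\<close>

lemma ind_mono:
  assumes i: "ind A B C" and A': "A' \<subseteq> cl d (A \<union> B)" and C': "C' \<subseteq> cl d (B \<union> C)"
  shows "ind A' B C'"
proof -
  have sm: "small A" "small B" "small C" using i by (auto simp: ind_def)
  define P where "P = cl d (A \<union> B)"
  define Q where "Q = cl d (B \<union> C)"
  have PQ: "small P" "small Q" unfolding P_def Q_def using sm small_Un small_cl by auto
  then have sm': "small A'" "small C'" using A' C' small_subset by (auto simp: P_def Q_def)
  have sub: "A \<union> B \<subseteq> P" "B \<union> C \<subseteq> Q" unfolding P_def Q_def by (rule cl_extensive)+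
  have "P \<union> Q \<subseteq> cl d (A \<union> B \<union> C)"
    unfolding P_def Q_def by (intro Un_least cl_mono) auto
  then have 1: "rk (P \<union> Q) = rk (A \<union> B \<union> C)"
    using sm sub by (intro rk_between) (auto simp: small_Un)
  have 2: "rk P = rk (A \<union> B)" "rk Q = rk (B \<union> C)"
    unfolding P_def Q_def using sm by (auto intro!: rk_between cl_extensive small_Un)
  have "rk (P \<union> (B \<union> C') \<union> Q) + rk (B \<union> C') \<le> rk (P \<union> (B \<union> C')) + rk Q"
    using PQ sm sm' small_Un sub C' by (intro rk_submod) (auto simp: Q_def)
  moreover have "P \<union> (B \<union> C') \<union> Q = P \<union> Q" using sub C' by (auto simp: Q_def)
  moreover have "rk (A' \<union> B \<union> C' \<union> P) + rk (A' \<union> B) \<le> rk (A' \<union> B \<union> C') + rk P"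
    using PQ sm sm' small_Un sub A' by (intro rk_submod) (auto simp: P_def)
  moreover have "A' \<union> B \<union> C' \<union> P = P \<union> (B \<union> C')" using A' by (auto simp: P_def)
  ultimately show ?thesis
    using i[unfolded ind_def] 1 2 unfolding ind_iff_ge[OF sm'(1) sm(2) sm'(2)] by simp
qed

lemma ind_base:
  assumes i: "ind A B C" and B': "B \<subseteq> B'" "B' \<subseteq> cl d (B \<union> C)"
  shows "ind A B' C"
proof -
  have sm: "small A" "small B" "small C" using i by (auto simp: ind_def)
  have smB: "small B'"
    using small_subset[OF small_cl[OF small_Un[OF sm(2,3)]] B'(2)] .
  have "ind A B B'" using ind_mono[OF i subset_cl B'(2)] by blast
  then have 1: "rk (A \<union> B') + rk B = rk (A \<union> B) + rk B'"
    using B'(1) by (simp add: ind_def Un_assoc Un_absorb1)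
  have "B' \<union> C \<subseteq> cl d (B \<union> C)" using B'(2) subset_cl[of C "B \<union> C"] by blast
  then have 2: "rk (B' \<union> C) = rk (B \<union> C)"
    using B'(1) sm by (intro rk_between) (auto simp: small_Un)
  have "A \<union> B' \<union> C \<subseteq> cl d (A \<union> B \<union> C)"
    using B'(2) cl_mono[of "B \<union> C" "A \<union> B \<union> C"] cl_extensive[of "A \<union> B \<union> C"] by blast
  then have 3: "rk (A \<union> B' \<union> C) = rk (A \<union> B \<union> C)"
    using B'(1) sm by (intro rk_between) (auto simp: small_Un)
  show ?thesis using 1 2 3 i smB by (simp add: ind_def)
qed

lemma ind_trans:
  assumes 1: "ind A B B'" and B: "B \<subseteq> B'" and 2: "ind A B' C"
  shows "ind A B C"
proof -
  have "A \<union> B \<union> B' = A \<union> B'" "B \<union> B' = B'" "A \<union> B \<union> (B' \<union> C) = A \<union> B' \<union> C"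
    "B \<union> (B' \<union> C) = B' \<union> C" using B by auto
  then have "ind A B (B' \<union> C)" using 1 2 by (simp add: ind_def small_Un)
  then show ?thesis by (rule ind_mono) (rule subset_cl, blast)+
qed

lemma fin_dim_over_rk:
  assumes X: "finite X" and Z: "small Z"
  shows "fin_dim_over d X Z = rk (X \<union> Z) - rk Z"
  unfolding fin_dim_over_def
proof (rule Min_eqI)
  have sm: "small (X \<union> Z)" using X Z small_finite small_Un by blast
  show "finite {d (X \<union> Y) - d Y |Y. finite Y \<and> Y \<subseteq> Z}"
    using fin_dim_over_set_finite[OF dim X] .
  show "rk (X \<union> Z) - rk Z \<le> y" if y: "y \<in> {d (X \<union> Y) - d Y |Y. finite Y \<and> Y \<subseteq> Z}" for y
  proof -
    obtain Y where Y: "y = d (X \<union> Y) - d Y" "finite Y" "Y \<subseteq> Z" using y by blast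
    have "rk (X \<union> Y \<union> Z) + rk Y \<le> rk (X \<union> Y) + rk Z"
      using X Y Z small_finite by (intro rk_submod) auto
    moreover have "X \<union> Y \<union> Z = X \<union> Z" using Y by blast
    ultimately show ?thesis using X Y by (simp add: rk_finite)
  qed
  obtain F where F: "finite F" "F \<subseteq> X \<union> Z" "d F = rk (X \<union> Z)" using rk_witness[OF sm] by blast
  obtain E where E: "finite E" "E \<subseteq> Z" "d E = rk Z" using rk_witness[OF Z] by blast
  define Y where "Y = F \<inter> Z \<union> E"
  have Y: "finite Y" "Y \<subseteq> Z" using F E by (auto simp: Y_def)
  have "d F \<le> d (X \<union> Y)" using F X Y by (intro d_mono) (auto simp: Y_def)
  moreover have "d (X \<union> Y) \<le> rk (X \<union> Z)" using X Y sm by (intro rk_ge) auto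
  moreover have "d E \<le> d Y" using Y by (intro d_mono) (auto simp: Y_def)
  moreover have "d Y \<le> rk Z" using Y Z by (intro rk_ge)
  ultimately have "rk (X \<union> Z) - rk Z = d (X \<union> Y) - d Y" using F E by simp
  then show "rk (X \<union> Z) - rk Z \<in> {d (X \<union> Y) - d Y |Y. finite Y \<and> Y \<subseteq> Z}" using Y by blast
qed

lemma dim_over_rk:
  assumes A: "small A" and Z: "small Z"
  shows "dim_over d A Z = rk (A \<union> Z) - rk Z"
  unfolding dim_over_def
proof (rule Max_eqI)
  have sm: "small (A \<union> Z)" using A Z by (rule small_Un)
  have "fin_dim_over d X Z \<in> {0..rk (A \<union> Z) - rk Z}" if "finite X" "X \<subseteq> A" for X
  proof -
    have "small (X \<union> Z)" using that Z small_finite small_Un by blast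
    then show ?thesis using fin_dim_over_rk[OF that(1) Z] rk_mono[OF sm, of "X \<union> Z"] that
        rk_mono[of "X \<union> Z" Z] by auto
  qed
  then have sub: "{fin_dim_over d X Z |X. finite X \<and> X \<subseteq> A} \<subseteq> {0..rk (A \<union> Z) - rk Z}" by blast
  show "finite {fin_dim_over d X Z |X. finite X \<and> X \<subseteq> A}"
    using finite_subset[OF sub] by simp
  show "y \<le> rk (A \<union> Z) - rk Z" if "y \<in> {fin_dim_over d X Z |X. finite X \<and> X \<subseteq> A}" for y
    using sub that by auto
  obtain F where F: "finite F" "F \<subseteq> A \<union> Z" "d F = rk (A \<union> Z)" using rk_witness[OF sm] by blast
  have X: "finite (F \<inter> A)" "F \<inter> A \<subseteq> A" using F by auto
  have "small (F \<inter> A \<union> Z)" using X Z small_finite small_Un by blast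
  then have "rk (A \<union> Z) \<le> rk (F \<inter> A \<union> Z)" using rk_ge[of "F \<inter> A \<union> Z" F] F by auto
  moreover have "rk (F \<inter> A \<union> Z) \<le> rk (A \<union> Z)" using sm by (rule rk_mono) auto
  ultimately have "rk (A \<union> Z) - rk Z = fin_dim_over d (F \<inter> A) Z"
    using fin_dim_over_rk[OF X(1) Z] by simp
  then show "rk (A \<union> Z) - rk Z \<in> {fin_dim_over d X Z |X. finite X \<and> X \<subseteq> A}" using X by blast
qed

lemma indep_iff_ind:
  assumes "small A" "small B" "small C"
  shows "indep d A B C \<longleftrightarrow> ind A B C"
  using assms by (simp add: indep_def dim_over_rk small_Un ind_def Un_assoc) linarith

lemma fin_closures_iff: "B \<in> fin_closures d \<longleftrightarrow> small B \<and> cl d B = B"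
proof
  assume "B \<in> fin_closures d"
  then show "small B \<and> cl d B = B"
    by (auto simp: fin_closures_def cl_idem intro: small_cl small_finite)
next
  assume B: "small B \<and> cl d B = B"
  obtain F where F: "finite F" "F \<subseteq> B" "d F = rk B" using rk_witness B by blast
  have "B \<subseteq> cl d F"
  proof
    fix a assume "a \<in> B"
    then have "d (insert a F) \<le> rk B" using F B by (intro rk_ge) auto
    then have "d (insert a F) = d F" using F d_mono[of "insert a F" F] by fastforce
    then show "a \<in> cl d F" unfolding mem_cl using F(1) by blast
  qed
  moreover have "cl d F \<subseteq> B" using cl_mono[OF F(2)] B by simp
  ultimately show "B \<in> fin_closures d" using F(1) by (auto simp: fin_closures_def)
qed

end

section \<open>Automorphisms of the structure\<close>

locale stationary_dimension = dimension_structure M d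
  for M :: "('f, 'r, 'a) fo_structure" and d :: "'a set \<Rightarrow> int" +
  assumes exist: "indep_existence M d" and stat: "indep_stationary M d"
begin

abbreviation Aut0 :: "('a \<Rightarrow> 'a) set" where
  "Aut0 \<equiv> Aut_over M (cl d {})"

lemma Aut_fun:
  "u \<in> Aut M \<Longrightarrow> (c, length xs) \<in> fun_symbols M
    \<Longrightarrow> fun_interp M (c, length xs) (map u xs) = u (fun_interp M (c, length xs) xs)"
  by (simp add: Aut_def)

lemma Aut_rel:
  "u \<in> Aut M \<Longrightarrow> (r, length xs) \<in> rel_symbols M
    \<Longrightarrow> rel_interp M (r, length xs) (map u xs) \<longleftrightarrow> rel_interp M (r, length xs) xs"
  unfolding Aut_def by blast

lemma AutI:
  assumes "bij u"
    and "\<And>c xs. (c, length xs) \<in> fun_symbols M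
      \<Longrightarrow> u (fun_interp M (c, length xs) xs) = fun_interp M (c, length xs) (map u xs)"
    and "\<And>r xs. (r, length xs) \<in> rel_symbols M
      \<Longrightarrow> rel_interp M (r, length xs) (map u xs) \<longleftrightarrow> rel_interp M (r, length xs) xs"
  shows "u \<in> Aut M"
  using assms unfolding Aut_def by blast

lemma Aut_bij: "u \<in> Aut M \<Longrightarrow> bij u"
  by (simp add: Aut_def)

text \<open>
  An automorphism condition involves finitely many points at a time, so it survives pointwise
  limits.
\<close>

lemma Aut_over_closed:
  assumes f: "bij f" "\<And>F. finite F \<Longrightarrow> \<exists>u\<in>Aut_over M S. \<forall>x\<in>F. u x = f x"
  shows "f \<in> Aut_over M S"
proof -
  have "f \<in> Aut M"
  proof (rule AutI[OF f(1)])
    fix c and xs :: "'a list" assume c: "(c, length xs) \<in> fun_symbols M"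
    obtain u where u: "u \<in> Aut M"
      "\<forall>x\<in>insert (fun_interp M (c, length xs) xs) (set xs). u x = f x"
      using f(2)[of "insert (fun_interp M (c, length xs) xs) (set xs)"]
      by (auto simp: Aut_over_def)
    then have m: "map u xs = map f xs" by simp
    show "f (fun_interp M (c, length xs) xs) = fun_interp M (c, length xs) (map f xs)"
      using Aut_fun[OF u(1) c, unfolded m] u(2) by simp
  next
    fix r and xs :: "'a list" assume r: "(r, length xs) \<in> rel_symbols M"
    obtain u where u: "u \<in> Aut M" "\<forall>x\<in>set xs. u x = f x"
      using f(2)[of "set xs"] by (auto simp: Aut_over_def)
    then have m: "map u xs = map f xs" by simp
    show "rel_interp M (r, length xs) (map f xs) \<longleftrightarrow> rel_interp M (r, length xs) xs"
      using Aut_rel[OF u(1) r, unfolded m] .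
  qed
  moreover have "f x = x" if "x \<in> S" for x
    using f(2)[of "{x}"] that by (auto simp: Aut_over_def)
  ultimately show ?thesis by (simp add: Aut_over_def)
qed

lemma Aut_id: "id \<in> Aut M"
  by (simp add: Aut_def)

lemma Aut_comp:
  assumes u: "u \<in> Aut M" and v: "v \<in> Aut M"
  shows "u \<circ> v \<in> Aut M"
proof (rule AutI)
  show "bij (u \<circ> v)" using u v Aut_bij bij_comp by blast
  fix c r and xs :: "'a list"
  have m: "map (u \<circ> v) xs = map u (map v xs)" by simp
  show "(u \<circ> v) (fun_interp M (c, length xs) xs) = fun_interp M (c, length xs) (map (u \<circ> v) xs)"
    if "(c, length xs) \<in> fun_symbols M"
    using Aut_fun[OF u, of c "map v xs"] Aut_fun[OF v that] that unfolding m by simp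
  show "rel_interp M (r, length xs) (map (u \<circ> v) xs) \<longleftrightarrow> rel_interp M (r, length xs) xs"
    if "(r, length xs) \<in> rel_symbols M"
    using Aut_rel[OF u, of r "map v xs"] Aut_rel[OF v that] that unfolding m length_map by simp
qed

lemma Aut_inv:
  assumes u: "u \<in> Aut M"
  shows "inv u \<in> Aut M"
proof (rule AutI)
  show "bij (inv u)" using Aut_bij[OF u] by (rule bij_imp_bij_inv)
  have ui: "u (inv u x) = x" "inv u (u x) = x" for x
    using Aut_bij[OF u] by (simp_all add: bij_is_surj surj_f_inv_f bij_is_inj)
  fix c r and xs :: "'a list"
  have m: "map u (map (inv u) xs) = xs" by (simp add: comp_def ui)
  show "inv u (fun_interp M (c, length xs) xs) = fun_interp M (c, length xs) (map (inv u) xs)"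
    if "(c, length xs) \<in> fun_symbols M"
    using Aut_fun[OF u, of c "map (inv u) xs"] that ui unfolding m length_map by metis
  show "rel_interp M (r, length xs) (map (inv u) xs) \<longleftrightarrow> rel_interp M (r, length xs) xs"
    if "(r, length xs) \<in> rel_symbols M"
    using Aut_rel[OF u, of r "map (inv u) xs"] that unfolding m length_map by simp
qed

lemma Aut0_Aut: "u \<in> Aut0 \<Longrightarrow> u \<in> Aut M"
  by (simp add: Aut_over_def)

lemma cl_image:
  assumes u: "u \<in> Aut M" shows "cl d (u ` S) = u ` cl d S"
proof
  have b: "bij u" using u by (simp add: Aut_def)
  then have ui: "u ` inv u ` T = T" "inv u ` u ` T = T" for T
    by (simp_all add: image_f_inv_f bij_is_surj image_inv_f_f bij_is_inj)
  have "inv u ` cl d (u ` S) \<subseteq> cl d S"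
    using cl_image_subset[OF Aut_inv[OF u], of "u ` S"] ui by simp
  then show "cl d (u ` S) \<subseteq> u ` cl d S" using image_mono[of _ _ u] ui by metis
qed (rule cl_image_subset[OF u])

lemma Aut_small_image: "u \<in> Aut M \<Longrightarrow> small S \<Longrightarrow> small (u ` S)"
  unfolding small_def using cl_image by (metis finite_imageI image_mono)

lemma rk_image:
  assumes u: "u \<in> Aut M" and S: "small S"
  shows "rk (u ` S) = rk S"
proof -
  have le: "rk T \<le> rk (v ` T)" if v: "v \<in> Aut M" and T: "small T" for v T
  proof -
    obtain F where F: "finite F" "F \<subseteq> T" "d F = rk T" using rk_witness[OF T] by blast
    have "d (v ` F) \<le> rk (v ` T)" using F Aut_small_image[OF v T] by (intro rk_ge) auto
    then show ?thesis using d_image[OF F(1) v] F by simp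
  qed
  have "bij u" using u by (simp add: Aut_def)
  then have "inv u ` u ` S = S" by (simp add: image_inv_f_f bij_is_inj)
  then show ?thesis using le[OF u S] le[OF Aut_inv[OF u] Aut_small_image[OF u S]] by simp
qed

lemma Aut_ind_image: "u \<in> Aut M \<Longrightarrow> ind A B C \<Longrightarrow> ind (u ` A) (u ` B) (u ` C)"
  unfolding ind_def by (simp add: image_Un[symmetric] rk_image Aut_small_image small_Un)

lemma ind_cl_iff:
  assumes "small A" "small B" "cl d B = B" "small C"
  shows "indep d (cl d A) B (cl d C) \<longleftrightarrow> ind A B C"
proof -
  have "ind (cl d A) B (cl d C) \<longleftrightarrow> ind A B C"
  proof
    show "ind A B C" if "ind (cl d A) B (cl d C)"
      using that by (rule ind_mono) (rule subset_cl, use cl_extensive in blast)+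
    show "ind (cl d A) B (cl d C)" if "ind A B C"
      using that by (rule ind_mono) (rule cl_mono, blast)+
  qed
  then show ?thesis using assms by (simp add: indep_iff_ind small_cl)
qed

lemma existence:
  assumes A: "small A" and B: "small B" "cl d B = B" and C: "small C"
  shows "\<exists>u\<in>Aut0. (\<forall>x\<in>B. u x = x) \<and> ind (u ` A) B C"
proof -
  have "cl d A \<in> fin_closures d" "B \<in> fin_closures d" "cl d C \<in> fin_closures d"
    using A B C by (simp_all add: fin_closures_iff small_cl cl_idem)
  then obtain u where u: "u \<in> Aut_over M B" "indep d (u ` cl d A) B (cl d C)"
    using exist unfolding indep_existence_def by blast
  have uA: "u \<in> Aut M" "\<forall>x\<in>B. u x = x" using u(1) by (auto simp: Aut_over_def)
  have "u \<in> Aut0" using uA cl_mono[of "{}" B] B by (auto simp: Aut_over_def)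
  moreover have "ind (u ` A) B C"
    using u(2) ind_cl_iff[OF Aut_small_image[OF uA(1) A] B C] cl_image[OF uA(1)] by simp
  ultimately show ?thesis using uA by blast
qed

lemma stationarity:
  assumes B: "small B" "cl d B = B" and u: "u \<in> Aut0" "\<forall>x\<in>B. u x = x"
    and i: "ind A B C" "ind (u ` A) B C"
  shows "\<exists>w\<in>Aut0. (\<forall>x\<in>A. w x = u x) \<and> (\<forall>x\<in>B \<union> C. w x = x)"
proof -
  have sm: "small A" "small C" using i by (auto simp: ind_def)
  note uA = Aut0_Aut[OF u(1)]
  let ?A = "cl d (A \<union> B)"
  have "u ` B = B" using u(2) by force
  then have uA1: "u ` ?A = cl d (u ` A \<union> B)" using cl_image[OF uA, of "A \<union> B"] by (simp add: image_Un)
  have BA: "B \<subseteq> ?A" "B \<subseteq> u ` ?A" unfolding uA1 by (rule subset_cl, blast)+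
  have clo: "?A \<in> fin_closures d" "u ` ?A \<in> fin_closures d" "B \<in> fin_closures d"
    "cl d C \<in> fin_closures d"
    using sm B Aut_small_image[OF uA] unfolding uA1
    by (simp_all add: fin_closures_iff small_cl cl_idem small_Un)
  have wide: "ind (T \<union> B) B C" if "ind T B C" for T
    using that by (rule ind_mono) (rule subset_cl, blast)+
  have "ind (A \<union> B) B C" "ind (u ` A \<union> B) B C"
    using wide i by blast+
  then have "indep d ?A B (cl d C)" "indep d (u ` ?A) B (cl d C)"
    using sm B Aut_small_image[OF uA] unfolding uA1 by (simp_all add: ind_cl_iff small_Un)
  moreover have "bij_betw u ?A (u ` ?A)"
    using uA by (auto simp: Aut_def bij_betw_def inj_on_def dest: bij_is_inj injD)
  ultimately obtain w where w: "w \<in> Aut M" "\<forall>x\<in>?A. w x = u x" "\<forall>x\<in>cl d C. w x = x"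
    using stat[unfolded indep_stationary_def, rule_format, OF clo, of u] BA u(2) uA by blast
  have wB: "w x = x" if "x \<in> B" for x using w(2) BA(1) u(2) that by auto
  then have "w \<in> Aut0" using w(1) cl_mono[of "{}" B] B by (auto simp: Aut_over_def)
  then show ?thesis
    using w wB cl_extensive[of "A \<union> B"] cl_extensive[of C] by blast
qed

sublocale si?: stationary_independence Aut0 "cl d" small ind
proof
  show "bij u" if "u \<in> Aut0" for u using that by (simp add: Aut_over_def Aut_def)
  show "id \<in> Aut0" using Aut_id by (simp add: Aut_over_def)
  show "u \<circ> v \<in> Aut0" if "u \<in> Aut0" "v \<in> Aut0" for u v
    using that Aut_comp by (simp add: Aut_over_def)
  show "inv u \<in> Aut0" if u: "u \<in> Aut0" for u
  proof -
    have "inv u (u x) = x" for x using u by (simp add: Aut_over_def Aut_def bij_is_inj)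
    then have "inv u x = x" if "u x = x" for x using that by metis
    then show ?thesis using u Aut_inv by (simp add: Aut_over_def)
  qed
  show "u x = x" if "u \<in> Aut0" "x \<in> cl d {}" for u x using that by (simp add: Aut_over_def)
  show "f \<in> Aut0" if "bij f" "\<And>F. finite F \<Longrightarrow> \<exists>u\<in>Aut0. \<forall>x\<in>F. u x = f x" for f
    using that by (rule Aut_over_closed)
  show "cl d (u ` S) = u ` cl d S" if "u \<in> Aut0" for u S
    using that by (intro cl_image Aut0_Aut)
  show "small (u ` S)" if "u \<in> Aut0" "small S" for u S
    using that by (intro Aut_small_image Aut0_Aut)
  show "ind (u ` A) (u ` B) (u ` C)" if "u \<in> Aut0" "ind A B C" for u A B C
    using that by (intro Aut_ind_image Aut0_Aut)
  show "small A \<and> small B \<and> small C" if "ind A B C" for A B C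
    using that by (simp add: ind_def)
qed (fact small_finite small_Un small_cl cl_extensive cl_mono cl_idem ind_sym
      ind_mono ind_base ind_trans existence stationarity)+

lemma flat_iff: "flat B \<longleftrightarrow> B \<in> fin_closures d"
  by (simp add: flat_def fin_closures_iff)

section \<open>Basic orbits\<close>

lemma stab_flat:
  assumes "flat B" shows "stab B = Aut_over M B"
proof -
  have "cl d {} \<subseteq> B" using cl_mono[of "{}" B] assms by (simp add: flat_def)
  then show ?thesis unfolding stab_def by (auto simp: Aut_over_def)
qed

lemma ind_refl_mem_cl:
  assumes "ind {a} B {a}" shows "a \<in> cl d B"
  using assms by (simp add: ind_def mem_cl_rk insert_commute)

text \<open>
  The defining property of a basic element says exactly this. It holds on the whole orbit since
  automorphisms fixing \<open>A\<close> transport it.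
\<close>

lemma basic_orbit_dichotomy:
  assumes A: "flat A" and D: "basic_orbit M d A D" and b: "b \<in> D"
    and C: "flat C" "A \<subseteq> C"
  shows "b \<in> C \<or> ind {b} A C"
proof -
  obtain c where c: "basic_over d c A" "D = orb M c A" using D by (auto simp: basic_orbit_def)
  obtain u where u: "u \<in> Aut M" "\<forall>x\<in>A. u x = x" "b = u c"
    using b c(2) by (auto simp: orb_def Aut_over_def)
  have sm: "small A" "small C" "small {c}" "small {b}"
    using A C by (simp_all add: flat_def small_finite)
  have uA: "u ` A = A" using u(2) by force
  define C' where "C' = inv u ` C"
  have bu: "bij u" using u(1) by (simp add: Aut_def)
  have uC': "u ` C' = C" using bu by (simp add: C'_def image_f_inv_f bij_is_surj)
  have "inv u ` A = A" using uA bu by (metis bij_is_inj image_inv_f_f)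
  then have AC': "A \<subseteq> C'" using C(2) image_mono[of A C "inv u"] by (simp add: C'_def)
  have C': "small C'" "cl d C' = C'"
    using C(1) Aut_small_image[OF Aut_inv[OF u(1)]] cl_image[OF Aut_inv[OF u(1)], of C]
    by (simp_all add: C'_def flat_def)
  have "c \<in> C' \<or> ind {c} A C'"
  proof (rule disjCI)
    assume "\<not> ind {c} A C'"
    moreover have "{c} \<union> A \<union> C' = {c} \<union> C'" "A \<union> C' = C'" using AC' by auto
    ultimately have "fin_dim_over d {c} C' < fin_dim_over d {c} A"
      using ind_iff_ge[of "{c}" A C'] sm C' by (simp add: fin_dim_over_rk)
    then show "c \<in> C'" using c(1) AC' C' by (auto simp: basic_over_def fin_closures_iff)
  qed
  then show ?thesis
  proof
    assume "c \<in> C'"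
    then show ?thesis using uC' u(3) by blast
  next
    assume "ind {c} A C'"
    then have "ind (u ` {c}) (u ` A) (u ` C')" by (rule Aut_ind_image[OF u(1)])
    then show ?thesis using uA uC' u(3) by simp
  qed
qed

end

locale basic_dimension = stationary_dimension M d
  for M :: "('f, 'r, 'a) fo_structure" and d :: "'a set \<Rightarrow> int" +
  fixes A D :: "'a set"
  assumes A_flat: "flat A" and basic: "basic_orbit M d A D" and spans: "cl d (A \<union> D) = UNIV"
begin

lemma basic_image:
  assumes u: "u \<in> Aut0" and b: "b \<in> D" and C: "flat C" "u ` A \<subseteq> C"
  shows "u b \<in> C \<or> ind {u b} (u ` A) C"
proof -
  have "A \<subseteq> inv u ` C" using image_mono[OF C(2), of "inv u"] u by simp
  then have "b \<in> inv u ` C \<or> ind {b} A (inv u ` C)"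
    using basic_orbit_dichotomy[OF A_flat basic b] flat_image[OF C(1) G_inv[OF u]] by blast
  then show ?thesis
  proof
    assume "ind {b} A (inv u ` C)"
    then have "ind (u ` {b}) (u ` A) (u ` inv u ` C)" using u by (intro ind_image)
    then show ?thesis using u by simp
  qed (use u in auto)
qed

lemma orbit_stab: "u \<in> stab A \<Longrightarrow> b \<in> D \<Longrightarrow> u b \<in> D"
proof -
  assume u: "u \<in> stab A" and b: "b \<in> D"
  obtain c where c: "D = orb M c A" using basic by (auto simp: basic_orbit_def)
  then obtain v where v: "v \<in> Aut_over M A" "b = v c" using b by (auto simp: orb_def)
  have "u \<circ> v \<in> Aut_over M A"
    using stab_comp[of u A v] u v(1) by (simp add: stab_flat[OF A_flat])
  then show "u b \<in> D" using c v(2) unfolding orb_def by force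
qed

lemma spans_small:
  assumes "small S"
  obtains F where "finite F" "F \<subseteq> D" "S \<subseteq> cl d (A \<union> F)"
proof -
  obtain P where P: "finite P" "S \<subseteq> cl d P" using assms unfolding small_def by blast
  have "\<exists>F. finite F \<and> F \<subseteq> D \<and> P \<subseteq> cl d (A \<union> F)" using P(1)
  proof (induction P rule: finite_induct)
    case (insert p P)
    then obtain F where F: "finite F" "F \<subseteq> D" "P \<subseteq> cl d (A \<union> F)" by blast
    have "p \<in> cl d (A \<union> D)" by (simp add: spans)
    then obtain E where E: "finite E" "E \<subseteq> A \<union> D" "p \<in> cl d E"
      using mem_cl by (metis order_refl)
    have "cl d E \<subseteq> cl d (A \<union> (F \<union> E \<inter> D))" "cl d (A \<union> F) \<subseteq> cl d (A \<union> (F \<union> E \<inter> D))"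
      using E(2) by (auto intro!: cl_mono)
    then show ?case using E F by (intro exI[of _ "F \<union> E \<inter> D"]) auto
  qed auto
  then show ?thesis using that P(2) cl_subset by (meson subset_trans)
qed

text \<open>
  Over a flat set above \<open>A\<close> all elements of \<open>D\<close> outside of it are free extensions of one type
  over \<open>A\<close>, so stationarity makes them conjugate.
\<close>

lemma same_type:
  assumes b: "b \<in> D" "b' \<in> D" and C: "flat C" "A \<subseteq> C" "b \<notin> C" "b' \<notin> C"
  obtains u where "u \<in> stab C" "u b = b'"
proof -
  obtain c where c: "D = orb M c A" using basic by (auto simp: basic_orbit_def)
  then obtain v v' where v: "v \<in> Aut_over M A" "v' \<in> Aut_over M A" "b = v c" "b' = v' c"
    using b by (auto simp: orb_def)
  have st: "v \<in> stab A" "v' \<in> stab A" using v by (simp_all add: stab_flat[OF A_flat])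
  define t where "t = v' \<circ> inv v"
  have tA: "t \<in> stab A" unfolding t_def using st stab_inv stab_comp by blast
  have tb: "t b = b'" using stab_in_G[OF st(1)] v by (simp add: t_def)
  have "ind {b} A C" "ind (t ` {b}) A C"
    using basic_orbit_dichotomy[OF A_flat basic] b C tb by auto
  then obtain w where "w \<in> Aut0" "\<forall>x\<in>{b}. w x = t x" "\<forall>x\<in>A \<union> C. w x = x"
    using si.stationarity[of A t "{b}" C] A_flat tA unfolding flat_def stab_def by auto
  then show ?thesis using that[of w] tb by (auto simp: stab_def)
qed

text \<open>
  Suppose the conclusion fails. Then, by the dichotomy for \<open>g b\<close> over \<open>g ` A\<close>, every
  \<open>b \<in> D\<close> outside a flat \<open>B0\<close> is interalgebraic with \<open>g b\<close> over \<open>B0\<close>. Hence \<open>g\<close> maps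
  closures of \<open>B0\<close> and large finite subsets of \<open>D\<close> into themselves, and onto themselves since
  the rank is preserved. Any flat \<open>Q\<close> above some fixed one lies in such a closure \<open>C\<close>. If \<open>u\<close> fixes \<open>Q\<close> pointwise and moves \<open>C\<close> to an independent copy over \<open>Q\<close>, then
  \<open>Q\<close> is the intersection of \<open>C\<close> and \<open>u ` C\<close>, so \<open>g\<close> preserves \<open>Q\<close> and is bounded.
\<close>

lemma unbounded_moves_basic:
  assumes g: "g \<in> Aut0" and nb: "\<not> cl_bounded d g" and B: "small B"
  shows "\<exists>b\<in>D. b \<notin> cl d B \<and> b \<notin> cl d (insert (g b) B)"
proof (rule ccontr)
  assume contra: "\<not> ?thesis"
  then have dep0: "b \<in> cl d (insert (g b) B)" if "b \<in> D" "b \<notin> cl d B" for b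
    using contra that by blast
  define B0 where "B0 = cl d (B \<union> A \<union> g ` A)"
  have smA: "small A" "small (g ` A)" using A_flat g small_image by (auto simp: flat_def)
  have B0: "flat B0" unfolding B0_def using B smA by (intro flat_hull small_Un)
  have B0sub: "B \<union> A \<union> g ` A \<subseteq> B0" unfolding B0_def by (rule cl_extensive)
  have dep: "b \<in> cl d (insert (g b) B0)" if "b \<in> D" "b \<notin> B0" for b
  proof -
    have "cl d B \<subseteq> B0" unfolding B0_def by (intro cl_mono) auto
    then have "b \<in> cl d (insert (g b) B)" using dep0 that by blast
    moreover have "cl d (insert (g b) B) \<subseteq> cl d (insert (g b) B0)"
      using B0sub by (intro cl_mono) auto
    ultimately show ?thesis by blast
  qed
  have gb: "g b \<in> cl d (insert b (B0 \<union> g ` B0))" if b: "b \<in> D" for b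
  proof (cases "b \<in> B0")
    case True
    then show ?thesis using cl_extensive[of "insert b (B0 \<union> g ` B0)"] by blast
  next
    case False
    define C where "C = cl d (insert b B0)"
    have C: "flat C" unfolding C_def
      using small_Un[OF small_finite[of "{b}"] flat_small[OF B0]] by (intro flat_hull) simp
    have BC: "insert b B0 \<subseteq> C" unfolding C_def by (rule cl_extensive)
    have "g b \<in> C"
    proof (rule ccontr)
      assume "g b \<notin> C"
      then have "ind {g b} (g ` A) C"
        using basic_image[OF g b C] B0sub BC by blast
      then have "ind {g b} B0 C" 
        by (rule ind_base) (use B0sub BC in \<open>auto intro!: subset_cl\<close>)
      then have "ind {b} B0 {g b}" by (rule ind_subset[OF ind_sym]) (use BC in auto)
      then have "ind {b} B0 {b}"
        by (rule ind_mono) (use dep[OF b False] cl_extensive[of "{b} \<union> B0"] in auto)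
      then have "b \<in> cl d B0" by (rule ind_refl_mem_cl)
      then show False using False B0 by (simp add: flat_def)
    qed
    moreover have "C \<subseteq> cl d (insert b (B0 \<union> g ` B0))" unfolding C_def by (intro cl_mono) auto
    ultimately show ?thesis by blast
  qed
  \<comment> \<open>The image of B0 need not lie in B0, but finitely many elements of D span it over A.\<close>
  obtain F0 where F0: "finite F0" "F0 \<subseteq> D" "g ` B0 \<subseteq> cl d (A \<union> F0)"
    using spans_small[OF small_image[OF g flat_small[OF B0]]] by blast
  have inv: "g ` cl d (B0 \<union> F) = cl d (B0 \<union> F)" if F: "finite F" "F0 \<subseteq> F" "F \<subseteq> D" for F
  proof -
    let ?C = "cl d (B0 \<union> F)"
    have sm: "small (B0 \<union> F)" "small ?C"
      using flat_small[OF B0] F(1) small_finite small_Un small_cl by auto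
    have "cl d (A \<union> F0) \<subseteq> ?C" using B0sub F(2) by (intro cl_mono) auto
    then have gB0: "g ` B0 \<subseteq> ?C" using F0(3) by blast
    have sub: "B0 \<union> F \<subseteq> ?C" by (rule cl_extensive)
    have "g b \<in> ?C" if "b \<in> F" for b
    proof -
      have "cl d (insert b (B0 \<union> g ` B0)) \<subseteq> ?C"
        using that gB0 sub by (intro cl_subset) auto
      then show ?thesis using gb F(3) that by blast
    qed
    then have "g ` (B0 \<union> F) \<subseteq> ?C" using gB0 by auto
    then have le: "g ` ?C \<subseteq> ?C" using cl_subset hull_image[OF g] by metis
    have "?C \<subseteq> g ` ?C"
    proof
      fix a assume a: "a \<in> ?C"
      have "rk ?C = rk (g ` ?C)" using rk_image[OF Aut0_Aut[OF g] sm(2)] by simp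
      moreover have "rk (g ` ?C) \<le> rk (insert a (g ` ?C))" "rk (insert a (g ` ?C)) \<le> rk ?C"
        using a le sm(2) by (auto intro!: rk_mono intro: small_subset)
      ultimately have "a \<in> cl d (g ` ?C)"
        using mem_cl_rk[OF small_image[OF g sm(2)]] by simp
      then show "a \<in> g ` ?C" using hull_image[OF g, of ?C] cl_idem by simp
    qed
    then show ?thesis using le by blast
  qed
  let ?E = "cl d (B0 \<union> F0)"
  have E: "flat ?E" using flat_small[OF B0] F0(1) small_finite small_Un by (intro flat_hull) auto
  have "g ` Q = Q" if Q: "Q \<in> fin_closures d" "?E \<subseteq> Q" for Q
  proof -
    have Qf: "flat Q" using Q(1) by (simp add: flat_iff)
    obtain F1 where F1: "finite F1" "F1 \<subseteq> D" "Q \<subseteq> cl d (A \<union> F1)"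
      using spans_small[OF flat_small[OF Qf]] by blast
    define F where "F = F0 \<union> F1"
    have F: "finite F" "F0 \<subseteq> F" "F \<subseteq> D" using F0 F1 by (auto simp: F_def)
    define C where "C = cl d (B0 \<union> F)"
    have smC: "small C" unfolding C_def
      using flat_small[OF B0] F(1) small_finite small_Un small_cl by auto
    have QC: "Q \<subseteq> C" using F1(3) cl_mono[of "A \<union> F1" "B0 \<union> F"] B0sub by (auto simp: C_def F_def)
    have BQ: "B0 \<union> F0 \<subseteq> Q" using Q(2) cl_extensive[of "B0 \<union> F0"] by blast
    obtain u where u: "u \<in> stab Q" "ind (u ` C) Q C"
      using existence_stab[OF smC Qf smC] by blast
    note uG = stab_in_G[OF u(1)]
    have uF: "F0 \<subseteq> u ` F" "u ` F \<subseteq> D"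
    proof -
      have "u x = x" if "x \<in> F0" for x using stab_fixes[OF u(1)] BQ that by blast
      then show "F0 \<subseteq> u ` F" using F(2) by force
      have "u \<in> stab A" using u(1) stab_antimono[of A Q] BQ B0sub by blast
      then show "u ` F \<subseteq> D" using orbit_stab F(3) by blast
    qed
    have "u ` B0 = B0" using stab_image[OF u(1)] BQ by simp
    then have uC: "u ` C = cl d (B0 \<union> u ` F)"
      using hull_image[OF uG, of "B0 \<union> F"] by (simp add: C_def image_Un)
    have CuC: "C \<inter> u ` C = Q"
    proof
      show "C \<inter> u ` C \<subseteq> Q"
      proof
        fix a assume "a \<in> C \<inter> u ` C"
        then have "ind {a} Q {a}" by (intro ind_subset[OF u(2)]) auto
        then have "a \<in> cl d Q" by (rule ind_refl_mem_cl)
        then show "a \<in> Q" using Qf by (simp add: flat_def)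
      qed
      have "u ` Q \<subseteq> u ` C" using QC by blast
      then show "Q \<subseteq> C \<inter> u ` C" using QC stab_image[OF u(1) order_refl] by simp
    qed
    have "g ` C = C" unfolding C_def using F by (rule inv)
    moreover have "g ` u ` C = u ` C" unfolding uC using F(1) uF by (intro inv) auto
    ultimately show ?thesis
      using image_Int[OF bij_is_inj[OF G_bij[OF g]], of C "u ` C"] CuC by simp
  qed
  then have "cl_bounded d g" using E unfolding cl_bounded_def flat_iff by blast
  then show False using nb by blast
qed

text \<open>
  Induction on \<open>F\<close>, moving one element at a time. The set \<open>Q\<close> above \<open>g ` B\<close> keeps the case alive
  in which the new element \<open>c\<close> depends on \<open>B\<close> and the earlier ones: its image then depends on
  \<open>g ` B\<close> and their images. Otherwise \<open>c\<close> can be replaced by any element of \<open>D\<close> outside the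
  relevant closure, in particular by one that is free from its own image over a very large set.
\<close>

lemma move_basic_set:
  assumes g: "g \<in> Aut0" "\<not> cl_bounded d g"
    and B: "flat B" "A \<union> g ` A \<subseteq> B" and Q: "small Q" "g ` B \<subseteq> Q"
    and F: "finite F" "F \<subseteq> D"
  shows "\<exists>u\<in>stab B. ind (u ` F) B (g ` u ` F \<union> Q)"
  using F
proof (induction F rule: finite_induct)
  case empty
  have "small {}" by (simp add: small_finite)
  then obtain u where "u \<in> stab B" "ind (u ` {}) B Q" using existence_stab[OF _ B(1) Q(1)] by blast
  then show ?case by auto
next
  case (insert b F)
  then obtain u where u: "u \<in> stab B" "ind (u ` F) B (g ` u ` F \<union> Q)" by auto
  have uA: "u \<in> stab A" using u(1) stab_antimono[of A B] B(2) by blast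
  define F' where "F' = u ` F"
  have FD: "finite F'" "F' \<subseteq> D" using insert orbit_stab[OF uA] by (auto simp: F'_def)
  have i: "ind F' B (g ` F' \<union> Q)" using u(2) by (simp add: F'_def)
  define c where "c = u b"
  have cD: "c \<in> D" using insert orbit_stab[OF uA] by (simp add: c_def)
  have smB: "small B" using B(1) by (rule flat_small)
  have "\<exists>v\<in>stab (cl d (B \<union> F')). ind (insert (v c) F') B (g ` insert (v c) F' \<union> Q)"
  proof (cases "c \<in> cl d (B \<union> F')")
    case True
    have "g c \<in> g ` cl d (B \<union> F')" using True by blast
    also have "\<dots> = cl d (g ` B \<union> g ` F')" using hull_image[OF g(1), of "B \<union> F'"] by (simp add: image_Un)
    also have "\<dots> \<subseteq> cl d (B \<union> (g ` F' \<union> Q))" using Q(2) by (intro cl_mono) auto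
    finally have gc: "g c \<in> cl d (B \<union> (g ` F' \<union> Q))" .
    have "ind (insert c F') B (g ` insert c F' \<union> Q)"
    proof (rule ind_mono[OF i])
      show "insert c F' \<subseteq> cl d (F' \<union> B)"
        using True cl_extensive[of "F' \<union> B"] by (simp add: Un_commute)
      show "g ` insert c F' \<union> Q \<subseteq> cl d (B \<union> (g ` F' \<union> Q))"
        using gc cl_extensive[of "B \<union> (g ` F' \<union> Q)"] by auto
    qed
    moreover have "id \<in> stab (cl d (B \<union> F'))" using G_id by (simp add: stab_def)
    ultimately show ?thesis by (metis id_apply)
  next
    case False
    have smF: "small F'" using FD(1) by (rule small_finite)
    let ?i = "inv g"
    \<comment> \<open>The preimages are included so that the image of the new element is independent from F'
        over B, the images of F' and Q: apply g to independence over the preimages of these sets.\<close>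
    define W where "W = B \<union> F' \<union> g ` F' \<union> Q \<union> ?i ` B \<union> ?i ` F' \<union> ?i ` Q"
    have W: "small W" unfolding W_def
      using smB smF Q(1) g(1) by (intro small_Un small_image G_inv) auto
    obtain b' where b': "b' \<in> D" "b' \<notin> cl d W" "b' \<notin> cl d (insert (g b') W)"
      using unbounded_moves_basic[OF g W] by blast
    have smb: "small {b'}" "small {g b'}" by (simp_all add: small_finite)
    have C: "flat (cl d (B \<union> F'))" using smB smF by (intro flat_hull small_Un)
    have AC: "A \<subseteq> cl d (B \<union> F')" using B(2) by (intro subset_cl) auto
    have "b' \<notin> cl d (B \<union> F')" using b'(2) cl_mono[of "B \<union> F'" W] by (auto simp: W_def)
    then obtain v where v: "v \<in> stab (cl d (B \<union> F'))" "v c = b'"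
      using same_type[OF cD b'(1) C AC False] by blast
    have "flat (cl d (insert (g b') W))"
      using small_Un[OF smb(2) W] by (intro flat_hull) simp
    moreover have "A \<subseteq> cl d (insert (g b') W)"
      using B(2) by (intro subset_cl) (auto simp: W_def)
    ultimately have "ind {b'} A (cl d (insert (g b') W))"
      using basic_orbit_dichotomy[OF A_flat basic b'(1), of "cl d (insert (g b') W)"] b'(3) by blast
    then have ib: "ind {b'} A (insert (g b') W)"
      by (rule ind_subset) (use cl_extensive[of "insert (g b') W"] in auto)
    have 1: "ind {b'} (B \<union> F') (g ` insert b' F' \<union> Q)"
    proof -
      have "ind {b'} (B \<union> F') (insert (g b') W)"
        by (rule ind_base[OF ib]) (use B(2) in \<open>auto simp: W_def intro!: subset_cl\<close>)
      then show ?thesis by (rule ind_subset) (auto simp: W_def)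
    qed
    have 2: "ind F' B (g ` insert b' F' \<union> Q)"
    proof -
      let ?E = "?i ` B \<union> F' \<union> ?i ` Q"
      have Ai: "A \<subseteq> ?i ` B" using image_mono[of "g ` A" B ?i] B(2) g(1) by simp
      have "ind {b'} ?E (insert (g b') W)"
        by (rule ind_base[OF ib]) (use Ai in \<open>auto simp: W_def intro!: subset_cl\<close>)
      then have "ind {b'} ?E (?i ` F')" by (rule ind_subset) (auto simp: W_def)
      then have "ind (g ` {b'}) (g ` ?E) (g ` ?i ` F')" by (rule ind_image[OF g(1)])
      then have near: "ind {g b'} (B \<union> (g ` F' \<union> Q)) F'"
        using g(1) by (simp add: image_Un Un_assoc)
      have far: "ind F' (B \<union> (g ` F' \<union> Q)) ({g b'} \<union> (g ` F' \<union> Q))"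
        by (rule ind_subset[OF ind_sym[OF near]]) auto
      have "ind F' B (B \<union> (g ` F' \<union> Q))" using i by (rule ind_subset) auto
      then have "ind F' B ({g b'} \<union> (g ` F' \<union> Q))" by (rule ind_trans[OF _ _ far]) simp
      then show ?thesis by simp
    qed
    have "ind (g ` insert b' F' \<union> Q) B ({b'} \<union> F')"
    proof (rule ind_trans)
      show "ind (g ` insert b' F' \<union> Q) B (B \<union> F')" by (rule ind_subset[OF ind_sym[OF 2]]) auto
      show "ind (g ` insert b' F' \<union> Q) (B \<union> F') ({b'} \<union> F')"
        by (rule ind_subset[OF ind_sym[OF 1]]) auto
    qed simp
    then have "ind (insert b' F') B (g ` insert b' F' \<union> Q)" by (simp add: ind_sym)
    then show ?thesis using v by blast
  qed
  then obtain v where v: "v \<in> stab (cl d (B \<union> F'))"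
    "ind (insert (v c) F') B (g ` insert (v c) F' \<union> Q)" by blast
  have "v x = x" if "x \<in> B \<union> F'" for x
    using stab_fixes[OF v(1)] cl_extensive[of "B \<union> F'"] that by blast
  then have "v ` F' = F'" "v \<in> stab B" using stab_in_G[OF v(1)] by (force, simp add: stab_def)
  moreover have "(v \<circ> u) ` insert b F = insert (v c) (v ` F')"
    by (auto simp: F'_def c_def)
  ultimately show ?case using v(2) u(1) stab_comp[of v B u] by (intro bexI[of _ "v \<circ> u"]) simp_all
qed

text \<open>
  A small set \<open>S\<close> is first made independent over \<open>B\<close> from a flat set \<open>B'\<close> containing \<open>A\<close> and
  its image, so it suffices to work over \<open>B'\<close>. There \<open>S\<close> is in the closure of \<open>A\<close> and a finite
  subset of \<open>D\<close>, and its image in the closure of \<open>g ` A\<close> and the image of that subset.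
\<close>

lemma unbounded_moves_almost_maximally:
  assumes g: "g \<in> Aut0" "\<not> cl_bounded d g"
  shows "moves_almost_maximally g"
  unfolding moves_almost_maximally_def
proof (intro allI impI, elim conjE)
  fix S B assume S: "small S" and B: "flat B"
  define B' where "B' = cl d (B \<union> A \<union> g ` A)"
  have B': "flat B'" unfolding B'_def
    using B A_flat g(1) by (intro flat_hull small_Un small_image flat_small) auto
  have sub: "B \<union> A \<union> g ` A \<subseteq> B'" unfolding B'_def by (rule cl_extensive)
  obtain v where v: "v \<in> stab B" "ind (v ` S) B B'"
    using existence_stab[OF S B flat_small[OF B']] by blast
  obtain F where F: "finite F" "F \<subseteq> D" "v ` S \<subseteq> cl d (A \<union> F)"
    using spans_small[of "v ` S"] small_image[OF stab_in_G[OF v(1)] S] by blast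
  have "small (g ` B')" using small_image[OF g(1) flat_small[OF B']] .
  then obtain u where u: "u \<in> stab B'" "ind (u ` F) B' (g ` u ` F \<union> g ` B')"
    using move_basic_set[OF g B' _ _ order_refl F(1,2)] sub by blast
  note uG = stab_in_G[OF u(1)]
  have uA: "u ` A = A" using stab_image[OF u(1)] sub by simp
  have uB: "u \<in> stab B" using u(1) stab_antimono[of B B'] sub by blast
  have uS: "u ` v ` S \<subseteq> cl d (A \<union> u ` F)"
    using image_mono[OF F(3), of u] hull_image[OF uG, of "A \<union> F"] by (simp add: image_Un uA)
  then have gS: "g ` u ` v ` S \<subseteq> cl d (g ` A \<union> g ` u ` F)"
    using image_mono[OF uS, of g] hull_image[OF g(1), of "A \<union> u ` F"] by (simp add: image_Un)
  have 1: "ind (u ` v ` S) B' (g ` u ` v ` S)"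
  proof (rule ind_mono[OF u(2)])
    have "cl d (A \<union> u ` F) \<subseteq> cl d (u ` F \<union> B')" using sub by (intro cl_mono) auto
    then show "u ` v ` S \<subseteq> cl d (u ` F \<union> B')" using uS by blast
    have "cl d (g ` A \<union> g ` u ` F) \<subseteq> cl d (B' \<union> (g ` u ` F \<union> g ` B'))"
      using sub by (intro cl_mono) auto
    then show "g ` u ` v ` S \<subseteq> cl d (B' \<union> (g ` u ` F \<union> g ` B'))" using gS by blast
  qed
  have "ind (u ` v ` S) (u ` B) (u ` B')" using v(2) by (rule ind_image[OF uG])
  then have 2: "ind (u ` v ` S) B B'" using stab_image[OF uB order_refl] stab_image[OF u(1) order_refl] by simp
  have "ind (u ` v ` S) B (g ` u ` v ` S)" by (rule ind_trans[OF 2 _ 1]) (use sub in auto)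
  moreover have "u \<circ> v \<in> stab B" using uB v(1) by (rule stab_comp)
  ultimately show "\<exists>w\<in>stab B. ind (w ` S) B (g ` w ` S)"
    by (intro bexI[of _ "u \<circ> v"]) (simp_all add: image_comp)
qed

lemma cl_bounded_inv:
  assumes g: "g \<in> Aut0" and b: "cl_bounded d (inv g)"
  shows "cl_bounded d g"
proof -
  obtain E where E: "E \<in> fin_closures d" "\<forall>B\<in>fin_closures d. E \<subseteq> B \<longrightarrow> inv g ` B = B"
    using b unfolding cl_bounded_def by auto
  have "g ` B = B" if "B \<in> fin_closures d" "E \<subseteq> B" for B
  proof -
    have "inv g ` B = B" using E(2) that by auto
    then show ?thesis using inv_image_right[OF g, of B] by simp
  qed
  then show ?thesis unfolding cl_bounded_def using E(1) by (intro bexI[of _ E]) auto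
qed

theorem unbounded_generates:
  assumes "countable (UNIV :: 'a set)" and g: "g \<in> Aut0" "\<not> cl_bounded d g" and f: "f \<in> Aut0"
  obtains k l where "\<forall>i<4. k i \<in> Aut0 \<and> l i \<in> Aut0" "f = word g l \<circ> word g k"
proof -
  have nb: "\<not> cl_bounded d (inv g)" using cl_bounded_inv[OF g(1)] g(2) by auto
  show ?thesis
    using eight_conjugates[OF assms(1) g(1) unbounded_moves_almost_maximally[OF g]
        unbounded_moves_almost_maximally[OF G_inv[OF g(1)] nb] f that] .
qed

end

section \<open>Ninety-six conjugates\<close>

theorem corollary3p13:
  fixes M :: "('f, 'r, 'a) fo_structure"
    and d :: "'a set \<Rightarrow> int"
    and A D :: "'a set"
    and g :: "'a \<Rightarrow> 'a"
  assumes "countable (UNIV :: 'a set)"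
    and "dimension_function M d"
    and "nonzero_dimension d"
    and "subsumes_dcl M d"
    and "indep_existence M d"
    and "indep_stationary M d"
    and "A \<in> fin_closures d"
    and "basic_orbit M d A D"
    and "cl d (A \<union> D) = UNIV"
    and "g \<in> Aut_over M (cl d {})"
    and "\<not> cl_bounded d g"
  shows "\<forall>h \<in> Aut_over M (cl d {}). \<exists>cs. length cs = 96
           \<and> set cs \<subseteq> conjugates_pm (Aut_over M (cl d {})) g
           \<and> h = foldr (\<circ>) cs id"
proof
  fix h assume h: "h \<in> Aut_over M (cl d {})"
  interpret stationary_dimension M d
    using assms(2,5,6) by unfold_locales
  interpret basic_dimension M d A D
    using assms(7-9) by unfold_locales (simp_all add: flat_iff)
  obtain k l where kl: "\<forall>i<4. k i \<in> Aut0 \<and> l i \<in> Aut0" and fac: "h = word g l \<circ> word g k"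
    using unbounded_generates[OF assms(1,10,11) h] by blast
  define cs where "cs = map (\<lambda>u. conj_by u g) [l 3, l 2, l 1, l 0, k 3, k 2, k 1, k 0]"
  define ps where "ps = concat (replicate 44 [g, inv g])"
  have "conj_by u g \<in> conjugates_pm Aut0 g" if "u \<in> Aut0" for u
    using that unfolding conjugates_pm_def conj_by_def by blast
  then have "set cs \<subseteq> conjugates_pm Aut0 g" using kl by (simp add: cs_def lt_four)
  moreover have "x \<in> conjugates_pm Aut0 g" if "x \<in> {g, inv g}" for x
    unfolding conjugates_pm_def using that G_id by (intro CollectI exI[of _ id] exI[of _ x]) auto
  then have "set ps \<subseteq> conjugates_pm Aut0 g" by (auto simp: ps_def)
  moreover have "length (cs @ ps) = 96" by (simp add: cs_def ps_def length_concat sum_list_replicate)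
  moreover have "foldr (\<circ>) (concat (replicate n [g, inv g])) id = id" for n
  proof (induction n)
    case (Suc n)
    then show ?case using inv_right[OF assms(10)] by (simp add: fun_eq_iff)
  qed simp
  then have "foldr (\<circ>) (cs @ ps) id = h"
    by (simp add: cs_def ps_def fac word_def comp_assoc)
  ultimately show "\<exists>cs. length cs = 96 \<and> set cs \<subseteq> conjugates_pm Aut0 g \<and> h = foldr (\<circ>) cs id"
    by (intro exI[of _ "cs @ ps"]) simp
qed

end
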